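(* Let $\pi$ be a regular pattern on the triod $T$ whose rotation number is different from $\frac13$. If the code function of $\pi$ is non-decreasing, then $\pi$ is a frontier pattern, i.e. the rotation number $\rho(\pi)$ is an end-point of the rotation interval $I_\pi$ forced by $\pi$.
   Context: **Triod and patterns.** The triod is $T=\{z\in\mathbb C: z^3\in[0,1]\}$ with branching point $a=0$; the three components of $T\setminus\{a\}$ are its branches. $\mathcal U$ is the set of continuous maps $f:T\to T$ whose unique fixed point is $a$. For $x,y\in T$ write $x>y$ if $x,y$ lie on the same branch and $x$ is farther from $a$ than $y$; $x\geqslant y$ means $x>y$ or $x=y$. $[A]$ denotes the convex hull of $A$ in $T$ (smallest closed connected set containing $A$). A cycle is a periodic orbit $P\subset T\setminus\{a\}$ of some $f\in\mathcal U$. Two cycles $P,Q$ (of maps $f,g\in\mathcal U$) are equivalent if there is a homeomorphism $h:[P]\to[Q]$ preserving each branch, with $h(P)=Q$ and $h\circ f=g\circ h$ on $P$; an equivalence class is a pattern, and $P$ exhibits its class. A pattern $A$ forces a pattern $B$ if every $f\in\mathcal U$ having a cycle of pattern $A$ also has a cycle of pattern $B$. A cycle/pattern is primitive if all its points lie on different branches. A pattern is regular if it does not force a primitive pattern of period $2$; a cycle is regular if its pattern is. For a cycle $P$, the $P$-linear map is the map in $\mathcal U$ that agrees with the given map on $P$, fixes $a$, is affine (with respect to arc length on $T$) on each component of $[P]\setminus(P\cup\{a\})$, and is constant on each component of $T\setminus[P]$. **Canonical ordering.** A regular cycle $P$ has points on all three branches, and the branches can be cyclically labelled $b_0,b_1,b_2$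 (indices mod 3) so that for every $i$ the point $p_i$ of $P$ in $b_i$ closest to $a$ is mapped into $b_{i+1}$. This labelling (canonical ordering) is always used. **Rotation numbers.** For a cycle $P$ with $P$-linear map $f$, let $G_P$ be the oriented graph with vertex set $P$ and an arrow $x\to y$ iff there is $z\in T$ with $x\geqslant z$ and $f(z)\geqslant y$. If $u\in b_i$, $v\in b_j$, $j\equiv i+k \pmod 3$, $k\in\{0,1,2\}$, the displacement of an arrow $u\to v$ is $d(u\to v)=\frac k3$. For a loop $\Gamma$ in $G_P$ of length $|\Gamma|$ let $d(\Gamma)$ be the sum of displacements along $\Gamma$ (an integer); its rotation pair is $(d(\Gamma),|\Gamma|)$ and its rotation number is $d(\Gamma)/|\Gamma|$. The rotation pair and rotation number of $P$ and of its pattern $\pi$ are those of the loop $x\to f(x)\to\dots\to f^{n-1}(x)\to x$ ($x\in P$, $n$ the period of $P$). The rotation interval $I_\pi$ forced by $\pi$ is the closure of the set of rotation numbers of all loops of $G_P$; it is a closed (possibly degenerate) interval. $\pi$ is a frontier pattern if $\rho(\pi)$ is an end-point of $I_\pi$. **Code function.** Let $P$ be a cycle with rotation number $\rho\ne\frac13$. Choose $x_0\in P$, put $\psi(x_0)=0$ and $\psi(f^k(x_0))=k\rho-\lfloor t_k\rfloor$ for $k\in\mathbb N$, where $t_k=\sum_{j=0}^{k-1}d(f^j(x_0)\to f^{j+1}(x_0))$. This gives a well-defined $\psi:P\to\mathbb R$, and $\psi(x)-\psi(y)$ does not depend on $x_0$ for $x,y$ on the same branch. The code function is non-decreasing if: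 in case $\rho<\frac13$, $\psi(x)\leqslant\psi(y)$ whenever $x>y$ ($x,y\in P$); in case $\rho>\frac13$, $\psi(x)\geqslant\psi(y)$ whenever $x>y$. A pattern has a non-decreasing code function if a (equivalently any) cycle exhibiting it does. *)

theory Defs
  imports "HOL-Analysis.Analysis"
begin

section \<open>The triod\<close>

definition triod :: "complex set" where
  "triod = {z. z ^ 3 \<in> complex_of_real ` {0..1}}"

definition branches :: "complex set set" where
  "branches = components (triod - {0})"

definition same_branch :: "complex \<Rightarrow> complex \<Rightarrow> bool" where
  "same_branch x y \<longleftrightarrow> (\<exists>b\<in>branches. x \<in> b \<and> y \<in> b)"

definition triod_gt :: "complex \<Rightarrow> complex \<Rightarrow> bool" where
  "triod_gt x y \<longleftrightarrow> same_branch x y \<and> dist 0 x > dist 0 y"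

definition triod_ge :: "complex \<Rightarrow> complex \<Rightarrow> bool" where
  "triod_ge x y \<longleftrightarrow> triod_gt x y \<or> x = y"

text \<open>The triod is a tree, so the intersection below is itself connected and is the least closed
  connected subset containing \<open>A\<close>.\<close>

definition triod_hull :: "complex set \<Rightarrow> complex set" where
  "triod_hull A = \<Inter>{C. A \<subseteq> C \<and> C \<subseteq> triod \<and> closed C \<and> connected C}"

text \<open>The arc length metric: two points on different branches are joined through the branching
  point \<open>0\<close>.\<close>

definition arc_dist :: "complex \<Rightarrow> complex \<Rightarrow> real" where
  "arc_dist x y = (if same_branch x y then dist x y else dist x 0 + dist 0 y)"

section \<open>Maps and cycles\<close>

text \<open>Maps of the triod are functions on the complex numbers whose values off the triod are
  irrelevant.\<close>

definition triod_maps :: "(complex \<Rightarrow> complex) set" where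
  "triod_maps = {f. f ` triod \<subseteq> triod \<and> continuous_on triod f \<and> {x \<in> triod. f x = x} = {0}}"

definition cycles :: "((complex \<Rightarrow> complex) \<times> complex set) set" where
  "cycles = {(f, P). f \<in> triod_maps \<and> P \<subseteq> triod - {0} \<and>
     (\<exists>x n. n > 0 \<and> (f ^^ n) x = x \<and> P = range (\<lambda>k. (f ^^ k) x))}"

text \<open>Affine with respect to arc length: on an interval, multiplying all arc length distances by a
  constant means running along a geodesic of the triod (possibly through the branching point) with
  constant speed.\<close>

definition arc_affine_on :: "complex set \<Rightarrow> (complex \<Rightarrow> complex) \<Rightarrow> bool" where
  "arc_affine_on J g \<longleftrightarrow> (\<exists>c\<ge>0. \<forall>x\<in>J. \<forall>y\<in>J. arc_dist (g x) (g y) = c * arc_dist x y)"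

definition is_linear_map :: "(complex \<Rightarrow> complex) \<Rightarrow> complex set \<Rightarrow> (complex \<Rightarrow> complex) \<Rightarrow> bool" where
  "is_linear_map f P g \<longleftrightarrow>
     g \<in> triod_maps \<and> (\<forall>x\<in>P. g x = f x) \<and> g 0 = 0 \<and>
     (\<forall>J\<in>components (triod_hull P - (P \<union> {0})). arc_affine_on J g) \<and>
     (\<forall>C\<in>components (triod - triod_hull P). g constant_on C)"

text \<open>On the triod, the map is determined by \<open>is_linear_map\<close>.\<close>

definition linear_map :: "(complex \<Rightarrow> complex) \<Rightarrow> complex set \<Rightarrow> complex \<Rightarrow> complex" where
  "linear_map f P = (SOME g. is_linear_map f P g)"

section \<open>Patterns\<close>

definition cycle_equiv ::
  "(((complex \<Rightarrow> complex) \<times> complex set) \<times> ((complex \<Rightarrow> complex) \<times> complex set)) set" where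
  "cycle_equiv = {((f, P), (g, Q)). (f, P) \<in> cycles \<and> (g, Q) \<in> cycles \<and>
     (\<exists>h k. homeomorphism (triod_hull P) (triod_hull Q) h k \<and>
        (\<forall>b\<in>branches. h ` (triod_hull P \<inter> b) = triod_hull Q \<inter> b) \<and>
        h ` P = Q \<and> (\<forall>x\<in>P. h (f x) = g (h x)))}"

text \<open>A pattern is a set of pairs \<open>(f, P)\<close>; the map \<open>f\<close> has a cycle of pattern \<open>A\<close> iff
  \<open>(f, P) \<in> A\<close> for some \<open>P\<close>.\<close>

type_synonym pattern = "((complex \<Rightarrow> complex) \<times> complex set) set"

definition patterns :: "pattern set" where
  "patterns = cycles // cycle_equiv"

definition forces :: "pattern \<Rightarrow> pattern \<Rightarrow> bool" where
  "forces A B \<longleftrightarrow> (\<forall>f\<in>triod_maps. (\<exists>P. (f, P) \<in> A) \<longrightarrow> (\<exists>Q. (f, Q) \<in> B))"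

definition primitive_cycle :: "complex set \<Rightarrow> bool" where
  "primitive_cycle P \<longleftrightarrow> (\<forall>x\<in>P. \<forall>y\<in>P. same_branch x y \<longrightarrow> x = y)"

text \<open>Primitivity and the period \<open>card P\<close> do not depend on the cycle exhibiting the pattern.\<close>

definition regular_pattern :: "pattern \<Rightarrow> bool" where
  "regular_pattern A \<longleftrightarrow> A \<in> patterns \<and>
     \<not> (\<exists>B\<in>patterns. (\<exists>(g, Q)\<in>B. primitive_cycle Q \<and> card Q = 2) \<and> forces A B)"

section \<open>Canonical ordering, rotation numbers, rotation interval\<close>

text \<open>A labelling is used only at the indices 0, 1, 2.\<close>

definition is_canonical_ordering ::
  "(complex \<Rightarrow> complex) \<Rightarrow> complex set \<Rightarrow> (nat \<Rightarrow> complex set) \<Rightarrow> bool" where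
  "is_canonical_ordering f P b \<longleftrightarrow> bij_betw b {..<3} branches \<and>
     (\<forall>i<3. \<exists>p \<in> P \<inter> b i. (\<forall>q \<in> P \<inter> b i. dist 0 p \<le> dist 0 q) \<and> f p \<in> b ((i + 1) mod 3))"

text \<open>For a regular cycle a canonical ordering exists and is unique up to a cyclic shift of the
  indices, which does not affect displacements.\<close>

definition canonical_ordering :: "(complex \<Rightarrow> complex) \<Rightarrow> complex set \<Rightarrow> nat \<Rightarrow> complex set" where
  "canonical_ordering f P = (SOME b. is_canonical_ordering f P b)"

definition displacement ::
  "(complex \<Rightarrow> complex) \<Rightarrow> complex set \<Rightarrow> complex \<Rightarrow> complex \<Rightarrow> real" where
  "displacement f P u v =
     real (THE k. k < 3 \<and> (\<exists>i<3. u \<in> canonical_ordering f P i \<and>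
                                v \<in> canonical_ordering f P ((i + k) mod 3))) / 3"

definition arrow :: "(complex \<Rightarrow> complex) \<Rightarrow> complex set \<Rightarrow> complex \<Rightarrow> complex \<Rightarrow> bool" where
  "arrow f P x y \<longleftrightarrow> x \<in> P \<and> y \<in> P \<and>
     (\<exists>z\<in>triod. triod_ge x z \<and> triod_ge (linear_map f P z) y)"

text \<open>A loop is given by the list of its successive vertices, with repetitions allowed; the last
  arrow leads back to the head of the list.\<close>

definition loops :: "(complex \<Rightarrow> complex) \<Rightarrow> complex set \<Rightarrow> complex list set" where
  "loops f P = {vs. vs \<noteq> [] \<and>
     (\<forall>i<length vs. arrow f P (vs ! i) (vs ! (Suc i mod length vs)))}"

definition loop_displacement :: "(complex \<Rightarrow> complex) \<Rightarrow> complex set \<Rightarrow> complex list \<Rightarrow> real" where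
  "loop_displacement f P vs =
     (\<Sum>i<length vs. displacement f P (vs ! i) (vs ! (Suc i mod length vs)))"

definition loop_rotation_number :: "(complex \<Rightarrow> complex) \<Rightarrow> complex set \<Rightarrow> complex list \<Rightarrow> real" where
  "loop_rotation_number f P vs = loop_displacement f P vs / real (length vs)"

definition cycle_loop :: "(complex \<Rightarrow> complex) \<Rightarrow> complex set \<Rightarrow> complex list" where
  "cycle_loop f P = (let x = (SOME x. x \<in> P) in map (\<lambda>k. (f ^^ k) x) [0..<card P])"

definition rotation_number :: "(complex \<Rightarrow> complex) \<Rightarrow> complex set \<Rightarrow> real" where
  "rotation_number f P = loop_rotation_number f P (cycle_loop f P)"

definition rotation_interval :: "(complex \<Rightarrow> complex) \<Rightarrow> complex set \<Rightarrow> real set" where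
  "rotation_interval f P = closure (loop_rotation_number f P ` loops f P)"

text \<open>Equivalent regular cycles have the same rotation number and the same rotation interval, so the
  choice of the cycle exhibiting the pattern is immaterial.\<close>

definition pattern_rotation_number :: "pattern \<Rightarrow> real" where
  "pattern_rotation_number \<pi> = (case SOME c. c \<in> \<pi> of (f, P) \<Rightarrow> rotation_number f P)"

definition pattern_rotation_interval :: "pattern \<Rightarrow> real set" where
  "pattern_rotation_interval \<pi> = (case SOME c. c \<in> \<pi> of (f, P) \<Rightarrow> rotation_interval f P)"

definition frontier_pattern :: "pattern \<Rightarrow> bool" where
  "frontier_pattern \<pi> \<longleftrightarrow>
     (\<exists>l u. l \<le> u \<and> pattern_rotation_interval \<pi> = {l..u} \<and> pattern_rotation_number \<pi> \<in> {l, u})"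

section \<open>Code function\<close>

definition is_code_function ::
  "(complex \<Rightarrow> complex) \<Rightarrow> complex set \<Rightarrow> complex \<Rightarrow> (complex \<Rightarrow> real) \<Rightarrow> bool" where
  "is_code_function f P x\<^sub>0 \<psi> \<longleftrightarrow>
     (\<forall>k. \<psi> ((f ^^ k) x\<^sub>0) = real k * rotation_number f P
        - real_of_int \<lfloor>\<Sum>j<k. displacement f P ((f ^^ j) x\<^sub>0) ((f ^^ Suc j) x\<^sub>0)\<rfloor>)"

text \<open>The differences \<open>\<psi> x - \<psi> y\<close> on a common branch do not depend on the base point.\<close>

definition nondecreasing_code :: "(complex \<Rightarrow> complex) \<Rightarrow> complex set \<Rightarrow> bool" where
  "nondecreasing_code f P \<longleftrightarrow> (\<exists>x\<^sub>0\<in>P. \<exists>\<psi>. is_code_function f P x\<^sub>0 \<psi> \<and>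
     (rotation_number f P < 1/3 \<longrightarrow> (\<forall>x\<in>P. \<forall>y\<in>P. triod_gt x y \<longrightarrow> \<psi> x \<le> \<psi> y)) \<and>
     (rotation_number f P > 1/3 \<longrightarrow> (\<forall>x\<in>P. \<forall>y\<in>P. triod_gt x y \<longrightarrow> \<psi> x \<ge> \<psi> y)))"

definition nondecreasing_code_pattern :: "pattern \<Rightarrow> bool" where
  "nondecreasing_code_pattern \<pi> \<longleftrightarrow> (\<exists>(f, P)\<in>\<pi>. nondecreasing_code f P)"

end

theory Submission
  imports Defs
begin

text \<open>The idea is to turn the code function into a potential. Removing from \<open>\<psi>\<close> a constant on each branch gives a
  function \<open>\<Phi>\<close> on the cycle with \<open>\<Phi> (f x) = \<Phi> x + \<rho> - d (x, f x)\<close>, where \<open>\<rho>\<close> is the rotation number and \<open>d\<close> the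
  displacement (\<open>code_function_potential\<close>); on each branch it is monotone in the same sense as \<open>\<psi>\<close>. For
  \<open>\<rho> < 1/3\<close> monotonicity yields \<open>\<Phi> y \<ge> \<Phi> x + \<rho> - d (x, y)\<close> along every arrow \<open>x \<rightarrow> y\<close>, not only along the
  arrows of the cycle. Summed over a loop of length \<open>n\<close> and displacement \<open>D\<close>, the potential cancels and
  \<open>D \<ge> n * \<rho>\<close> remains (\<open>loop_displacement_bound\<close>). So \<open>\<rho>\<close>, itself the rotation number of a loop, is the least
  one; for \<open>\<rho> > 1/3\<close> all inequalities are reversed and it is the greatest one.

  To use this for the graph of the linear map, its arrows must be described by the cycle alone: \<open>x \<rightarrow> y\<close> holds iff
  \<open>x \<ge> x'\<close> and \<open>f x' \<ge> y\<close> for some \<open>x'\<close> in the cycle (\<open>arrow_iff\<close>). The linear map runs along geodesics between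
  adjacent points of the cycle, and in a tree a point of a geodesic lies below one of its end-points. The
  existence of the linear map (\<open>linear_map_exists\<close>) and much else depends on one observation: a map whose only
  fixed point is the branching point never moves a point outwards on its own branch (\<open>no_expanded_point\<close>).

  Regularity provides the canonical ordering (\<open>canonical_ordering_exists\<close>). The points of the cycle nearest to the
  branching point are mapped to other branches; if two of them exchanged their branches, or if only two branches
  were met, then a primitive cycle of period \<open>2\<close> would be forced (\<open>regular_no_exchange\<close>), so the three branches are
  permuted cyclically.

  Finally, the closure of the set of rotation numbers of loops is an interval (\<open>rotation_interval_is_interval\<close>),
  since the graph is strongly connected and so any two loops can be mixed in equal proportions.\<close>

section \<open>Coordinates on the triod\<close>

abbreviation directions :: "complex set" where
  "directions \<equiv> {u. u ^ 3 = 1}"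

lemma card_directions: "card directions = 3"
  using card_roots_unity_eq[of 3] by simp

lemma finite_directions [simp]: "finite directions"
  using card_directions by (metis card.infinite zero_neq_numeral)

lemma norm_direction: "u ^ 3 = 1 \<Longrightarrow> norm (u::complex) = 1"
  by (metis norm_ge_zero norm_one norm_power power_eq_imp_eq_base power_one zero_le_one zero_less_numeral)

text \<open>Distinct cube roots of unity enclose an angle of \<open>120\<close> degrees: \<open>w = u * cnj v\<close> is a root of
  \<open>w\<^sup>2 + w + 1\<close>, and dividing by \<open>w\<close> gives \<open>2 * Re w = - 1\<close>.\<close>

lemma inner_directions:
  fixes u v :: complex
  assumes "u ^ 3 = 1" "v ^ 3 = 1" "u \<noteq> v"
  shows "u \<bullet> v \<le> 0"
proof -
  have nu: "norm u = 1" and nv: "norm v = 1"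
    using assms norm_direction by auto
  define w where "w = u * cnj v"
  have cv: "cnj v ^ 3 = 1" using assms(2) 
    by (simp flip: complex_cnj_power)
  have vv: "v * cnj v = 1" using nv by (simp add: complex_norm_square [symmetric])
  have w3: "w ^ 3 = 1" by (simp add: w_def power_mult_distrib assms cv)
  have "w \<noteq> 1"
  proof
    assume "w = 1"
    then have "w * v = v" by simp
    then have "u * (v * cnj v) = v" by (simp add: w_def algebra_simps)
    then show False using vv assms(3) by simp
  qed
  moreover have "(w - 1) * (w\<^sup>2 + w + 1) = w ^ 3 - 1"
    by (simp add: algebra_simps power2_eq_square power3_eq_cube)
  ultimately have q: "w\<^sup>2 + w + 1 = 0" using w3 by auto
  have ww: "w * cnj w = 1"
  proof -
    have "norm w = 1" using nu nv by (simp add: w_def norm_mult)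
    then show ?thesis by (simp add: complex_norm_square [symmetric])
  qed
  have "cnj w * (w\<^sup>2 + w + 1) = (w * cnj w) * w + w * cnj w + cnj w"
    by (simp add: algebra_simps power2_eq_square)
  then have "w + 1 + cnj w = 0" using q ww by simp
  then have "Re (w + 1 + cnj w) = 0" by simp
  then have "Re w < 0" by simp
  then show ?thesis by (simp add: w_def inner_complex_def add.commute)
qed

text \<open>Polar description of the triod. A branch is recorded by its direction \<open>sgn z\<close>, a cube root of unity;
  together with \<open>norm z\<close> it determines the point.\<close>

lemma triod_iff: "z \<in> triod \<longleftrightarrow> z = 0 \<or> (norm z \<le> 1 \<and> sgn z \<in> directions)"
proof (cases "z = 0")
  case True
  then show ?thesis by (auto simp: triod_def intro!: image_eqI[of _ _ 0])
next
  case False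
  have z3: "z ^ 3 = complex_of_real (norm z ^ 3) * sgn z ^ 3"
    using False by (simp add: sgn_div_norm scaleR_conv_of_real power_mult_distrib field_simps)
  show ?thesis
  proof
    assume "z \<in> triod"
    then obtain s where s: "0 \<le> s" "s \<le> 1" "z ^ 3 = complex_of_real s"
      by (auto simp: triod_def)
    have n: "norm z ^ 3 = s"
      using s by (metis norm_power norm_of_real abs_of_nonneg)
    have "norm z \<le> 1" using n s power_le_one_iff[of "norm z" 3] by simp
    moreover have "complex_of_real (norm z ^ 3) * sgn z ^ 3 = complex_of_real (norm z ^ 3)"
      using z3 s(3) n by metis
    then have "sgn z ^ 3 = 1" using False by simp
    ultimately show "z = 0 \<or> (norm z \<le> 1 \<and> sgn z \<in> directions)" by simp
  next
    assume "z = 0 \<or> (norm z \<le> 1 \<and> sgn z \<in> directions)"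
    then have "norm z ^ 3 \<le> 1" "z ^ 3 = complex_of_real (norm z ^ 3)"
      using False z3 by (auto intro: power_le_one)
    then show "z \<in> triod" unfolding triod_def by (auto intro!: image_eqI[of _ _ "norm z ^ 3"])
  qed
qed

lemma zero_in_triod [simp]: "0 \<in> triod"
  by (simp add: triod_iff)

lemma scaleR_direction_in_triod: "u ^ 3 = 1 \<Longrightarrow> 0 \<le> t \<Longrightarrow> t \<le> 1 \<Longrightarrow> t *\<^sub>R u \<in> triod"
  by (cases "t = 0") (auto simp: triod_iff sgn_scaleR norm_direction sgn_div_norm[of u])

lemma scaleR_in_triod: "p \<in> triod \<Longrightarrow> 0 \<le> t \<Longrightarrow> t \<le> 1 \<Longrightarrow> t *\<^sub>R p \<in> triod"
  by (cases "t = 0 \<or> p = 0") (auto simp: triod_iff sgn_scaleR intro!: mult_le_one)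

lemma sgn_scaleR_direction: "u ^ 3 = 1 \<Longrightarrow> 0 < t \<Longrightarrow> sgn (t *\<^sub>R u) = (u::complex)"
  by (simp add: sgn_scaleR norm_direction sgn_div_norm[of u])

lemma norm_scaleR_sgn: "norm z *\<^sub>R sgn z = (z::complex)"
  by (cases "z = 0") (simp_all add: sgn_div_norm)

lemma same_direction_eq: "sgn z = sgn w \<Longrightarrow> norm z = norm w \<Longrightarrow> z = (w::complex)"
  by (metis norm_scaleR_sgn)

text \<open>On the triod this is the coordinate along the branch with direction \<open>u\<close>, extended by \<open>0\<close> to the two
  other branches, that is, the retraction of the triod onto that branch. Since other branches make obtuse angles
  with \<open>u\<close>, the positive part of the inner product computes it, and its continuity is plain.\<close>

definition radius_along :: "complex \<Rightarrow> complex \<Rightarrow> real" where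
  "radius_along u z = max 0 (z \<bullet> u)"

lemma radius_along_eq:
  assumes "z \<in> triod" "u ^ 3 = 1"
  shows "radius_along u z = (if sgn z = u then norm z else 0)"
proof (cases "z = 0")
  case True
  then show ?thesis by (simp add: radius_along_def)
next
  case False
  then have s: "sgn z ^ 3 = 1" using assms triod_iff by auto
  have "z \<bullet> u = norm z * (sgn z \<bullet> u)"
    by (metis inner_scaleR_left norm_scaleR_sgn)
  moreover have "u \<bullet> u = 1" using norm_direction[OF assms(2)] by (simp add: norm_eq_1)
  ultimately show ?thesis
    using mult_nonneg_nonpos[OF norm_ge_zero[of z] inner_directions[OF s assms(2)]] False
    by (auto simp: radius_along_def max_def)
qed

lemma continuous_on_radius_along [continuous_intros]:
  "continuous_on S f \<Longrightarrow> continuous_on S (\<lambda>x. radius_along u (f x))"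
  unfolding radius_along_def by (intro continuous_intros)

lemma radius_along_nonneg: "0 \<le> radius_along u z"
  by (simp add: radius_along_def)

lemma radius_along_0 [simp]: "radius_along u 0 = 0"
  by (simp add: radius_along_def)

lemma radius_along_le_1: "z \<in> triod \<Longrightarrow> u ^ 3 = 1 \<Longrightarrow> radius_along u z \<le> 1"
  using triod_iff radius_along_eq by auto

lemma radius_along_pos_imp:
  assumes "z \<in> triod" "u ^ 3 = 1" "0 < radius_along u z"
  shows "z = radius_along u z *\<^sub>R u"
  using assms radius_along_eq norm_scaleR_sgn by (metis less_irrefl)

definition branch :: "complex \<Rightarrow> complex set" where
  "branch u = {z \<in> triod - {0}. sgn z = u}"

text \<open>The direction is continuous away from \<open>0\<close> and takes at most three values.\<close>

lemma connected_imp_one_branch: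
  assumes "connected C" "C \<subseteq> triod - {0}" "x \<in> C" "y \<in> C"
  shows "sgn x = sgn y"
proof -
  have "continuous_on C sgn"
    using assms(2) by (intro continuous_intros) auto
  moreover have "sgn ` C \<subseteq> directions"
    using assms(2) triod_iff by auto
  then have "finite (sgn ` C)" using finite_directions finite_subset by blast
  ultimately have "sgn constant_on C"
    using assms(1) continuous_finite_range_constant by blast
  then show ?thesis using assms by (auto simp: constant_on_def)
qed

lemma branch_image: "u ^ 3 = 1 \<Longrightarrow> branch u = (\<lambda>t. t *\<^sub>R u) ` {0<..1}"
proof -
  assume u: "u ^ 3 = 1"
  have "u \<noteq> 0" using u by auto
  then show ?thesis
    using u
    by (auto simp: branch_def sgn_scaleR_direction scaleR_direction_in_triod)
      (metis greaterThanAtMost_iff imageI norm_scaleR_sgn triod_iff zero_less_norm_iff)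
qed

lemma connected_branch: "u ^ 3 = 1 \<Longrightarrow> connected (branch u)"
  unfolding branch_image
  by (intro connected_continuous_image continuous_intros) auto

lemma branch_nonempty: "u ^ 3 = 1 \<Longrightarrow> u \<in> branch u"
  by (auto simp: branch_image intro!: image_eqI[of _ _ 1])

lemma branches_eq: "branches = branch ` directions"
proof -
  have br: "branch u \<in> components (triod - {0})" if u: "u ^ 3 = 1" for u
    unfolding in_components_maximal
  proof (intro conjI allI impI)
    show "branch u \<noteq> {}" using branch_nonempty[OF u] by auto
    show "branch u \<subseteq> triod - {0}" by (auto simp: branch_def)
    show "connected (branch u)" using connected_branch[OF u] .
    fix d assume d: "d \<noteq> {} \<and> branch u \<subseteq> d \<and> d \<subseteq> triod - {0} \<and> connected d"
    have "u \<in> d" using d branch_nonempty[OF u] by auto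
    moreover have "sgn u = u" using u norm_direction by (simp add: sgn_div_norm)
    ultimately have "sgn z = u" if "z \<in> d" for z
      using connected_imp_one_branch d that by metis
    then show "d = branch u" using d by (auto simp: branch_def)
  qed
  show ?thesis unfolding branches_def
  proof
    show "components (triod - {0}) \<subseteq> branch ` directions"
    proof
      fix C assume C: "C \<in> components (triod - {0})"
      then obtain x where x: "x \<in> C" using in_components_nonempty by blast
      then have x': "x \<in> triod - {0}" using C in_components_subset by blast
      then have s: "sgn x ^ 3 = 1" using triod_iff by auto
      have "x \<in> branch (sgn x)" using x' by (simp add: branch_def)
      then have "C = branch (sgn x)"
        using components_nonoverlap[OF C br[OF s]] x by blast
      then show "C \<in> branch ` directions" using s by blast
    qed
  qed (use br in auto)
qed

lemma same_branch_iff: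
  "same_branch x y \<longleftrightarrow> x \<in> triod - {0} \<and> y \<in> triod - {0} \<and> sgn x = sgn y"
proof -
  have "sgn x ^ 3 = 1" if "x \<in> triod - {0}" for x
    using that triod_iff by auto
  then show ?thesis
    unfolding same_branch_def branches_eq by (force simp: branch_def)
qed

lemma triod_gt_iff:
  "triod_gt x y \<longleftrightarrow> x \<in> triod - {0} \<and> y \<in> triod - {0} \<and> sgn x = sgn y \<and> norm y < norm x"
  by (auto simp: triod_gt_def same_branch_iff)

lemma triod_ge_iff:
  assumes "y \<in> triod - {0}"
  shows "triod_ge x y \<longleftrightarrow> x \<in> triod - {0} \<and> sgn x = sgn y \<and> norm y \<le> norm x"
  using assms same_direction_eq unfolding triod_ge_def triod_gt_iff
  by (metis order_le_less order.refl)

lemma triod_ge_radius: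
  assumes "y \<in> triod - {0}" "x \<in> triod"
  shows "triod_ge x y \<longleftrightarrow> norm y \<le> radius_along (sgn y) x"
proof -
  have "sgn y ^ 3 = 1" using assms triod_iff by auto
  then show ?thesis
    using assms radius_along_eq[of x "sgn y"] triod_ge_iff[of y x] by auto
qed

text \<open>The three coordinates embed the triod with its arc length metric isometrically into \<open>\<real>\<^sup>3\<close> with the
  \<open>l\<^sub>1\<close> norm, since at most one coordinate of a point is nonzero.\<close>

lemma arc_dist_radius:
  assumes "x \<in> triod" "y \<in> triod"
  shows "arc_dist x y = (\<Sum>u\<in>directions. \<bar>radius_along u x - radius_along u y\<bar>)"
proof -
  have eq: "\<bar>radius_along u x - radius_along u y\<bar> =
     \<bar>(if sgn x = u then norm x else 0) - (if sgn y = u then norm y else 0)\<bar>"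
    if "u \<in> directions" for u
    using that assms by (simp add: radius_along_eq)
  have dir: "sgn z \<in> directions" if "z \<in> triod" "z \<noteq> 0" for z
    using that triod_iff by auto
  have one: "(\<Sum>u\<in>directions. if sgn z = u then norm z else 0) = norm z" if "z \<in> triod" for z
    using dir[OF that] by (cases "z = 0") (auto simp: sum.delta')
  have "(\<Sum>u\<in>directions. \<bar>radius_along u x - radius_along u y\<bar>) = arc_dist x y"
  proof (cases "x = 0 \<or> y = 0 \<or> sgn x \<noteq> sgn y")
    case True
    then have "arc_dist x y = norm x + norm y"
      by (auto simp: arc_dist_def same_branch_iff)
    moreover have "(\<Sum>u\<in>directions. \<bar>radius_along u x - radius_along u y\<bar>) =
       (\<Sum>u\<in>directions. (if sgn x = u then norm x else 0) + (if sgn y = u then norm y else 0))"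
      using True by (intro sum.cong) (auto simp: eq)
    ultimately show ?thesis by (simp only: sum.distrib one assms)
  next
    case False
    then have "arc_dist x y = dist x y"
      using assms by (auto simp: arc_dist_def same_branch_iff)
    also have "\<dots> = norm (norm x *\<^sub>R sgn x - norm y *\<^sub>R sgn x)"
      using False by (metis dist_norm norm_scaleR_sgn)
    also have "\<dots> = \<bar>norm x - norm y\<bar>"
      using False by (simp add: norm_sgn flip: scaleR_diff_left)
    finally have "arc_dist x y = \<bar>norm x - norm y\<bar>" .
    moreover have "(\<Sum>u\<in>directions. \<bar>radius_along u x - radius_along u y\<bar>) =
       (\<Sum>u\<in>directions. if sgn x = u then \<bar>norm x - norm y\<bar> else 0)"
      using False by (intro sum.cong) (auto simp: eq)
    ultimately show ?thesis
      using dir[OF assms(1)] False by (auto simp: sum.delta')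
  qed
  then show ?thesis by simp
qed

lemma arc_dist_same_direction:
  assumes "x \<in> triod" "y \<in> triod" "x \<noteq> 0" "y \<noteq> 0" "sgn x = sgn y"
  shows "arc_dist x y = \<bar>norm x - norm y\<bar>"
proof -
  have "arc_dist x y = dist x y"
    using assms by (auto simp: arc_dist_def same_branch_iff)
  also have "\<dots> = norm (norm x *\<^sub>R sgn x - norm y *\<^sub>R sgn x)"
    using assms by (metis dist_norm norm_scaleR_sgn)
  also have "\<dots> = \<bar>norm x - norm y\<bar>"
    using assms by (simp add: norm_sgn flip: scaleR_diff_left)
  finally show ?thesis .
qed

section \<open>Geodesics\<close>

text \<open>If \<open>z\<close> lies metrically between \<open>a\<close> and \<open>b\<close>, then the triangle inequality is an equality in each of the
  three coordinates, so no coordinate of \<open>z\<close> exceeds both of those of \<open>a\<close> and \<open>b\<close>.\<close>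

lemma geodesic_point_below_endpoint:
  assumes T: "a \<in> triod" "z \<in> triod" "b \<in> triod"
    and btw: "arc_dist a z + arc_dist z b = arc_dist a b"
    and y: "y \<in> triod - {0}" "triod_ge z y"
  shows "triod_ge a y \<or> triod_ge b y"
proof -
  define u where "u = sgn y"
  have u: "u ^ 3 = 1" using y triod_iff by (auto simp: u_def)
  define r where "r = radius_along"
  have "(\<Sum>v\<in>directions. \<bar>r v a - r v b\<bar>) =
     (\<Sum>v\<in>directions. \<bar>r v a - r v z\<bar> + \<bar>r v z - r v b\<bar>)"
    using btw by (simp add: arc_dist_radius T sum.distrib r_def)
  then have "\<bar>r u a - r u b\<bar> = \<bar>r u a - r u z\<bar> + \<bar>r u z - r u b\<bar>"
    by (rule sum_mono_inv) (use u in auto)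
  moreover have "norm y \<le> r u z" using y T triod_ge_radius by (simp add: r_def u_def)
  ultimately have "norm y \<le> r u a \<or> norm y \<le> r u b" by linarith
  then show ?thesis using triod_ge_radius y T by (simp add: r_def u_def)
qed

text \<open>The geodesic is a segment if both points lie on one closed branch; otherwise it first runs along the branch
  of \<open>a\<close> to the branching point and then out to \<open>b\<close>. In the second case \<open>p s\<close> below is the signed distance from
  the branching point, negative on the branch of \<open>a\<close>.\<close>

lemma geodesic_exists:
  assumes a: "a \<in> triod" and b: "b \<in> triod"
  obtains \<gamma> :: "real \<Rightarrow> complex" where
    "continuous_on UNIV \<gamma>" "\<gamma> 0 = a" "\<gamma> 1 = b" "\<And>s. 0 \<le> s \<Longrightarrow> s \<le> 1 \<Longrightarrow> \<gamma> s \<in> triod"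
    "\<And>s t. 0 \<le> s \<Longrightarrow> s \<le> 1 \<Longrightarrow> 0 \<le> t \<Longrightarrow> t \<le> 1 \<Longrightarrow>
       arc_dist (\<gamma> s) (\<gamma> t) = arc_dist a b * \<bar>s - t\<bar>"
proof (cases "a = 0 \<or> b = 0 \<or> sgn a = sgn b")
  case True
  obtain u where u: "u ^ 3 = 1" "a = norm a *\<^sub>R u" "b = norm b *\<^sub>R u"
  proof (cases "a = 0")
    case a0: True
    show ?thesis
    proof (cases "b = 0")
      case True
      then show ?thesis using that[of 1] a0 by simp
    next
      case False
      then have "sgn b ^ 3 = 1" using b triod_iff by auto
      then show ?thesis using that[of "sgn b"] a0 norm_scaleR_sgn by simp
    qed
  next
    case False
    then have s: "sgn a ^ 3 = 1" using a triod_iff by auto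
    have "norm b *\<^sub>R sgn a = b" using True False norm_scaleR_sgn
      by (metis norm_zero scaleR_zero_left)
    then show ?thesis using that[OF s] norm_scaleR_sgn by simp
  qed
  define \<rho> where "\<rho> s = (1 - s) * norm a + s * norm b" for s
  have le1: "norm a \<le> 1" "norm b \<le> 1" using a b triod_iff by force+
  have \<rho>: "0 \<le> \<rho> s \<and> \<rho> s \<le> 1" if "0 \<le> s" "s \<le> 1" for s
    using that le1 convex_bound_le[of "norm a" 1 "norm b" "1 - s" s] by (simp add: \<rho>_def)
  have dist: "arc_dist (s *\<^sub>R u) (t *\<^sub>R u) = \<bar>s - t\<bar>"
    if st: "0 \<le> s" "s \<le> 1" "0 \<le> t" "t \<le> 1" for s t
  proof -
    have "arc_dist (s *\<^sub>R u) (t *\<^sub>R u) = (\<Sum>v\<in>directions. if v = u then \<bar>s - t\<bar> else 0)"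
      unfolding arc_dist_radius[OF scaleR_direction_in_triod[OF u(1) st(1,2)]
          scaleR_direction_in_triod[OF u(1) st(3,4)]]
    proof (intro sum.cong refl)
      fix v assume v: "v \<in> directions"
      have "radius_along v (r *\<^sub>R u) = (if v = u then r else 0)" if "0 \<le> r" "r \<le> 1" for r
        using v u that
        by (cases "r = 0") (auto simp: radius_along_eq scaleR_direction_in_triod
            sgn_scaleR_direction norm_direction)
      then show "\<bar>radius_along v (s *\<^sub>R u) - radius_along v (t *\<^sub>R u)\<bar> =
          (if v = u then \<bar>s - t\<bar> else 0)"
        using st by simp
    qed
    then show ?thesis using u by simp
  qed
  have ab: "arc_dist a b = \<bar>norm a - norm b\<bar>"
    using dist[of "norm a" "norm b"] le1 u by simp
  show ?thesis
  proof
    show "continuous_on UNIV (\<lambda>s. \<rho> s *\<^sub>R u)" unfolding \<rho>_def by (intro continuous_intros)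
    show "\<rho> 0 *\<^sub>R u = a" "\<rho> 1 *\<^sub>R u = b" using u by (simp_all add: \<rho>_def)
    show "\<rho> s *\<^sub>R u \<in> triod" if "0 \<le> s" "s \<le> 1" for s
      using that u \<rho> scaleR_direction_in_triod by blast
    show "arc_dist (\<rho> s *\<^sub>R u) (\<rho> t *\<^sub>R u) = arc_dist a b * \<bar>s - t\<bar>"
      if "0 \<le> s" "s \<le> 1" "0 \<le> t" "t \<le> 1" for s t
    proof -
      have "\<rho> s - \<rho> t = (norm b - norm a) * (s - t)" by (simp add: \<rho>_def algebra_simps)
      then show ?thesis using dist[of "\<rho> s" "\<rho> t"] \<rho> that ab
        by (simp add: abs_mult abs_minus_commute)
    qed
  qed
next
  case False
  define L where "L = norm a + norm b"
  have ua: "sgn a ^ 3 = 1" and ub: "sgn b ^ 3 = 1" using a b False triod_iff by auto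
  have le1: "norm a \<le> 1" "norm b \<le> 1" using a b triod_iff by force+
  have pos: "0 < norm a" "0 < norm b" using False by auto
  define p where "p s = s * L - norm a" for s
  define \<gamma> where "\<gamma> s = max 0 (- p s) *\<^sub>R sgn a + max 0 (p s) *\<^sub>R sgn b" for s
  have ab: "arc_dist a b = L" using False by (auto simp: arc_dist_def same_branch_iff L_def)
  have p: "- norm a \<le> p s \<and> p s \<le> norm b" if "0 \<le> s" "s \<le> 1" for s
  proof -
    have "0 \<le> s * L" "s * L \<le> L" using that pos
      by (auto simp: L_def mult_left_le_one_le)
    then show ?thesis by (auto simp: p_def L_def)
  qed
  have T: "\<gamma> s \<in> triod" if "0 \<le> s" "s \<le> 1" for s
    using p[OF that] ua ub le1 scaleR_direction_in_triod[of "sgn a" "- p s"]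
      scaleR_direction_in_triod[of "sgn b" "p s"]
    by (cases "p s \<le> 0") (auto simp: \<gamma>_def max_def)
  have rad: "radius_along v (\<gamma> s) =
      (if v = sgn a then max 0 (- p s) else 0) + (if v = sgn b then max 0 (p s) else 0)"
    if "0 \<le> s" "s \<le> 1" "v ^ 3 = 1" for v s
  proof -
    consider "p s < 0" | "p s = 0" | "p s > 0" by linarith
    then show ?thesis
    proof cases
      case 1
      then have "\<gamma> s = (- p s) *\<^sub>R sgn a" by (simp add: \<gamma>_def)
      then show ?thesis using radius_along_eq[OF T[OF that(1,2)] that(3)] 1
          sgn_scaleR_direction[OF ua, of "- p s"] False norm_direction[OF ua] by auto
    next
      case 2
      then show ?thesis by (simp add: \<gamma>_def)
    next
      case 3
      then have "\<gamma> s = p s *\<^sub>R sgn b" by (simp add: \<gamma>_def)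
      then show ?thesis using radius_along_eq[OF T[OF that(1,2)] that(3)] 3
          sgn_scaleR_direction[OF ub, of "p s"] False norm_direction[OF ub] by auto
    qed
  qed
  show ?thesis
  proof
    show "continuous_on UNIV \<gamma>" unfolding \<gamma>_def p_def by (intro continuous_intros)
    show "\<gamma> 0 = a" using norm_scaleR_sgn by (simp add: \<gamma>_def p_def)
    show "\<gamma> 1 = b" using norm_scaleR_sgn by (simp add: \<gamma>_def p_def L_def)
    show "\<gamma> s \<in> triod" if "0 \<le> s" "s \<le> 1" for s using T that .
    show "arc_dist (\<gamma> s) (\<gamma> t) = arc_dist a b * \<bar>s - t\<bar>"
      if st: "0 \<le> s" "s \<le> 1" "0 \<le> t" "t \<le> 1" for s t
    proof -
      have "arc_dist (\<gamma> s) (\<gamma> t) =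
         (\<Sum>v\<in>directions. (if v = sgn a then \<bar>max 0 (- p s) - max 0 (- p t)\<bar> else 0)
            + (if v = sgn b then \<bar>max 0 (p s) - max 0 (p t)\<bar> else 0))"
        using st False by (simp add: arc_dist_radius T rad) (intro sum.cong, auto)
      also have "\<dots> = \<bar>max 0 (- p s) - max 0 (- p t)\<bar> + \<bar>max 0 (p s) - max 0 (p t)\<bar>"
        using ua ub by (simp add: sum.distrib)
      also have "\<dots> = \<bar>p s - p t\<bar>" by (auto simp: max_def)
      also have "p s - p t = L * (s - t)" by (simp add: p_def algebra_simps)
      finally show ?thesis using ab pos by (simp add: abs_mult L_def)
    qed
  qed
qed

section \<open>Convex hulls of finite sets\<close>

text \<open>The coordinate along the branch of \<open>p\<close> maps \<open>C\<close> to an interval, and positive coordinates determine points.\<close>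

lemma segment_subset_connected:
  assumes C: "connected C" "C \<subseteq> triod" "0 \<in> C" "p \<in> C" and t: "0 \<le> t" "t \<le> 1"
  shows "t *\<^sub>R p \<in> C"
proof (cases "p = 0 \<or> t = 0")
  case True
  then show ?thesis using C by auto
next
  case False
  define u where "u = sgn p"
  have u: "u ^ 3 = 1" using C False triod_iff by (auto simp: u_def)
  have "connected (radius_along u ` C)"
    using C(1) by (intro connected_continuous_image continuous_intros)
  moreover have "0 \<in> radius_along u ` C"
    using C(3) by (metis image_eqI radius_along_0)
  moreover have "norm p \<in> radius_along u ` C"
    using C u radius_along_eq by (auto simp: u_def intro!: image_eqI[of _ _ p])
  ultimately have "t * norm p \<in> radius_along u ` C"
    using t connected_contains_Icc[of "radius_along u ` C" 0 "norm p"]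
    by (simp add: mult_left_le_one_le subset_iff)
  then obtain z where z: "z \<in> C" "radius_along u z = t * norm p" by auto
  then have "z = (t * norm p) *\<^sub>R u"
    using radius_along_pos_imp[of z u] C u t False by auto
  then have "z = t *\<^sub>R p" by (simp add: u_def flip: scaleR_scaleR) (simp add: norm_scaleR_sgn)
  then show ?thesis using z by simp
qed

text \<open>A connected subset of the triod that meets two branches contains the branching point, hence all
  segments from there to its points; the union of these segments is closed and connected.\<close>

lemma triod_hull_eq:
  assumes P: "finite P" "P \<subseteq> triod - {0}" "x \<in> P" "y \<in> P" "sgn x \<noteq> sgn y"
  shows "triod_hull P = {t *\<^sub>R p | t p. 0 \<le> t \<and> t \<le> 1 \<and> p \<in> P}" (is "_ = ?S")
proof
  have S: "?S = (\<Union>p\<in>P. closed_segment 0 p)"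
    by (auto simp: closed_segment_def)
  have "closed ?S" unfolding S using P(1) by auto
  moreover have "connected ?S" unfolding S
  proof (rule connected_Union)
    show "\<Inter> (closed_segment 0 ` P) \<noteq> {}" by auto
  qed auto
  moreover have "?S \<subseteq> triod"
  proof
    fix z assume "z \<in> ?S"
    then obtain t p where tp: "z = t *\<^sub>R p" "0 \<le> t" "t \<le> 1" "p \<in> P" by auto
    then show "z \<in> triod" using P scaleR_in_triod by blast
  qed
  moreover have "P \<subseteq> ?S"
  proof
    fix p assume "p \<in> P"
    then have "p = 1 *\<^sub>R p \<and> 0 \<le> (1::real) \<and> (1::real) \<le> 1 \<and> p \<in> P" by simp
    then show "p \<in> ?S" by blast
  qed
  ultimately show "triod_hull P \<subseteq> ?S" unfolding triod_hull_def by blast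
  show "?S \<subseteq> triod_hull P"
  proof
    fix z assume "z \<in> ?S"
    then obtain t p where tp: "z = t *\<^sub>R p" "0 \<le> t" "t \<le> 1" "p \<in> P" by auto
    show "z \<in> triod_hull P" unfolding triod_hull_def
    proof (rule InterI, clarify)
      fix C assume C: "P \<subseteq> C" "C \<subseteq> triod" "closed C" "connected C"
      have "0 \<in> C"
      proof (rule ccontr)
        assume "0 \<notin> C"
        then have "sgn x = sgn y" using connected_imp_one_branch[of C x y] C P by blast
        then show False using P by simp
      qed
      then show "z \<in> C" using segment_subset_connected[of C p t] C tp by blast
    qed
  qed
qed

section \<open>Cycles\<close>

lemma cycles_basic:
  assumes "(f, P) \<in> cycles"
  shows "f \<in> triod_maps" "P \<subseteq> triod - {0}" "finite P" "P \<noteq> {}" "f ` P \<subseteq> P"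
    and "\<And>x. x \<in> P \<Longrightarrow> bij_betw (\<lambda>k. (f ^^ k) x) {..<card P} P"
    and "\<And>x. x \<in> P \<Longrightarrow> (f ^^ card P) x = x"
    and "\<And>x y. x \<in> P \<Longrightarrow> y \<in> P \<Longrightarrow> \<exists>k. y = (f ^^ k) x"
proof -
  obtain x0 n where f: "f \<in> triod_maps" and P0: "P \<subseteq> triod - {0}" and n: "n > 0"
    and x0: "(f ^^ n) x0 = x0" and P: "P = range (\<lambda>k. (f ^^ k) x0)"
    using assms by (auto simp: cycles_def)
  show "f \<in> triod_maps" "P \<subseteq> triod - {0}" by fact+
  show "P \<noteq> {}" using P by auto
  have "(f ^^ k) x0 \<in> (\<lambda>k. (f ^^ k) x0) ` {..<n}" for k
    using funpow_mod_eq[OF x0, of k] n by (metis imageI lessThan_iff mod_less_divisor)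
  then have "P \<subseteq> (\<lambda>k. (f ^^ k) x0) ` {..<n}" using P by auto
  then show "finite P" using finite_surj by blast
  show "f ` P \<subseteq> P"
  proof
    fix y assume "y \<in> f ` P"
    then obtain k where "y = f ((f ^^ k) x0)" using P by auto
    then have "y = (f ^^ Suc k) x0" by simp
    then show "y \<in> P" using P by blast
  qed
  fix x assume x: "x \<in> P"
  then obtain k where k: "x = (f ^^ k) x0" using P by auto
  have fnx: "(f ^^ n) x = x"
    by (metis add.commute comp_apply funpow_add k x0)
  \<comment> \<open>Going on from \<open>x\<close> to the next multiple of the period leads back to \<open>x0\<close>.\<close>
  have "(f ^^ (n * k - k)) x = (f ^^ (n * k)) x0"
    using n by (simp add: k flip: funpow_add comp_apply[of "f ^^ (n * k - k)" "f ^^ k"])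
  also have "\<dots> = x0" using funpow_mod_eq[OF x0, of "n * k"] by simp
  finally have x0x: "(f ^^ (n * k - k)) x = x0" .
  show ex: "\<exists>k. y = (f ^^ k) x" if yP: "y \<in> P" for y
  proof -
    obtain j where "y = (f ^^ j) x0" using yP P by auto
    then have "y = (f ^^ (j + (n * k - k))) x" by (simp add: funpow_add x0x)
    then show ?thesis by blast
  qed
  define m where "m = (LEAST m. m > 0 \<and> (f ^^ m) x = x)"
  have m: "m > 0 \<and> (f ^^ m) x = x" unfolding m_def
    by (rule LeastI[of _ n]) (use n fnx in auto)
  have least: "m \<le> j" if "j > 0" "(f ^^ j) x = x" for j
    unfolding m_def using that by (intro Least_le) auto
  have inj: "inj_on (\<lambda>k. (f ^^ k) x) {..<m}"
  proof (rule linorder_inj_onI')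
    fix i j assume ij: "i \<in> {..<m}" "j \<in> {..<m}" "i < j"
    show "(f ^^ i) x \<noteq> (f ^^ j) x"
    proof
      assume eq: "(f ^^ i) x = (f ^^ j) x"
      have "x = (f ^^ (m - i)) ((f ^^ i) x)"
        using ij m by (simp flip: funpow_add comp_apply[of "f ^^ (m - i)" "f ^^ i"])
      also have "\<dots> = (f ^^ (j - i)) ((f ^^ m) x)"
        using ij by (simp add: eq add.commute flip: funpow_add comp_apply[of "f ^^ (m - i)" "f ^^ j"]
            comp_apply[of "f ^^ (j - i)" "f ^^ m"])
      finally have "(f ^^ (j - i)) x = x" using m by simp
      then show False using least[of "j - i"] ij by auto
    qed
  qed
  have img: "(\<lambda>k. (f ^^ k) x) ` {..<m} = P"
  proof
    show "P \<subseteq> (\<lambda>k. (f ^^ k) x) ` {..<m}"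
    proof
      fix y assume "y \<in> P"
      then obtain j where "y = (f ^^ j) x" using ex by blast
      then have "y = (f ^^ (j mod m)) x" using funpow_mod_eq[of m f x j] m by simp
      then show "y \<in> (\<lambda>k. (f ^^ k) x) ` {..<m}" using m by auto
    qed
    show "(\<lambda>k. (f ^^ k) x) ` {..<m} \<subseteq> P"
      using k P by (auto simp flip: funpow_add comp_apply[of "f ^^ _" "f ^^ k"])
  qed
  have "card P = m" using img card_image[OF inj] by simp
  then show "bij_betw (\<lambda>k. (f ^^ k) x) {..<card P} P" "(f ^^ card P) x = x"
    using inj img m by (auto simp: bij_betw_def)
qed

lemma cycle_iterate_in: "(f, P) \<in> cycles \<Longrightarrow> x \<in> P \<Longrightarrow> (f ^^ k) x \<in> P"
  using cycles_basic(5) by (induction k) auto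

lemma cycle_sgn_cube:
  "(f, P) \<in> cycles \<Longrightarrow> x \<in> P \<Longrightarrow> sgn x ^ 3 = 1"
  using cycles_basic(2) triod_iff by blast

section \<open>Maps without other fixed points\<close>

lemma triod_maps_basic:
  assumes "f \<in> triod_maps"
  shows "x \<in> triod \<Longrightarrow> f x \<in> triod" "f 0 = 0" "continuous_on triod f"
    "x \<in> triod \<Longrightarrow> f x = x \<Longrightarrow> x = 0"
  using assms unfolding triod_maps_def by blast+

lemma continuous_on_ray:
  assumes f: "f \<in> triod_maps" and u: "u ^ 3 = 1"
  shows "continuous_on {0..1} (\<lambda>t. f (t *\<^sub>R u))"
  by (rule continuous_on_compose2[OF triod_maps_basic(3)[OF f]])
    (use u scaleR_direction_in_triod in \<open>auto intro!: continuous_intros\<close>)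

text \<open>Retract \<open>f\<close> onto the branch of \<open>x\<close>. If \<open>f x \<ge> x\<close>, then between \<open>x\<close> and the end of the branch the
  retracted map has a fixed point by the intermediate value theorem. It is nonzero, so it is a fixed point of
  \<open>f\<close> itself.\<close>

lemma no_expanded_point:
  assumes f: "f \<in> triod_maps" and x: "x \<in> triod - {0}"
  shows "\<not> triod_ge (f x) x"
proof
  assume ge: "triod_ge (f x) x"
  define u where "u = sgn x"
  have u: "u ^ 3 = 1" using x triod_iff by (auto simp: u_def)
  define \<phi> where "\<phi> t = radius_along u (f (t *\<^sub>R u))" for t
  have n: "0 < norm x" "norm x \<le> 1" using x triod_iff by auto
  have xu: "norm x *\<^sub>R u = x" by (simp add: u_def norm_scaleR_sgn)
  have "norm x \<le> \<phi> (norm x)"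
    using ge triod_ge_radius[of x "f x"] triod_maps_basic(1)[OF f] x
    by (simp add: \<phi>_def xu) (simp add: u_def)
  moreover have "\<phi> 1 \<le> 1"
    unfolding \<phi>_def
    by (intro radius_along_le_1 triod_maps_basic(1)[OF f] scaleR_direction_in_triod u) auto
  moreover have "continuous_on {norm x..1} (\<lambda>t. \<phi> t - t)"
    unfolding \<phi>_def using n
    by (intro continuous_intros continuous_on_subset[OF continuous_on_ray[OF f u]]) auto
  ultimately obtain t where t: "norm x \<le> t" "t \<le> 1" "\<phi> t - t = 0"
    using IVT2'[of "\<lambda>t. \<phi> t - t" 1 0 "norm x"] n by auto
  have tT: "t *\<^sub>R u \<in> triod" using t n u order_trans[OF norm_ge_zero t(1)]
    by (intro scaleR_direction_in_triod) auto
  have "f (t *\<^sub>R u) = \<phi> t *\<^sub>R u"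
    using radius_along_pos_imp[OF triod_maps_basic(1)[OF f tT] u] t order_less_le_trans[OF n(1) t(1)]
    by (simp add: \<phi>_def)
  then have "t *\<^sub>R u = 0" using triod_maps_basic(4)[OF f tT] t by simp
  then show False using t n u by auto
qed

text \<open>Again by the intermediate value theorem, now for the composition \<open>\<eta>\<close> of \<open>f\<close> with itself, retracted first
  to the branch of \<open>q\<close> and then to that of \<open>p\<close>. Retracting keeps the values at most \<open>1\<close>, so that
  \<open>\<eta> 1 \<le> 1\<close>. The fixed point sought must avoid the trivial one at \<open>0\<close>;
  for this the search starts at a point of the branch that \<open>f\<close> sends to \<open>q\<close>.\<close>

lemma two_cycle_exists:
  assumes f: "f \<in> triod_maps" and u: "u ^ 3 = 1" and v: "v ^ 3 = 1"
    and p: "p \<in> triod - {0}" "sgn p = u" and q: "q \<in> triod - {0}" "sgn q = v"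
    and pq: "triod_ge (f p) q" and qp: "triod_ge (f q) p"
  obtains w where "w \<in> triod - {0}" "f w \<in> triod - {0}" "f (f w) = w" "sgn w = u" "sgn (f w) = v"
proof -
  define \<phi> where "\<phi> t = radius_along v (f (t *\<^sub>R u))" for t
  define \<eta> where "\<eta> t = radius_along u (f (\<phi> t *\<^sub>R v))" for t
  note T = triod_maps_basic(1)[OF f]
  have np: "0 < norm p" "norm p \<le> 1" and nq: "0 < norm q" "norm q \<le> 1"
    using p q triod_iff by auto
  have pu: "norm p *\<^sub>R u = p" and qv: "norm q *\<^sub>R v = q"
    using p q norm_scaleR_sgn by auto
  have \<phi>1: "0 \<le> \<phi> t \<and> \<phi> t \<le> 1" if "0 \<le> t" "t \<le> 1" for t
    unfolding \<phi>_def using that u v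
    by (intro conjI radius_along_nonneg radius_along_le_1 T scaleR_direction_in_triod)
  have \<phi>c: "continuous_on {0..1} \<phi>"
    unfolding \<phi>_def by (intro continuous_intros continuous_on_ray f u)
  have "continuous_on {0..1} (\<lambda>t. f (\<phi> t *\<^sub>R v))"
    by (rule continuous_on_compose2[OF continuous_on_ray[OF f v] \<phi>c])
      (simp add: image_subset_iff \<phi>1)
  then have \<eta>c: "continuous_on {0..1} \<eta>"
    unfolding \<eta>_def by (intro continuous_intros)
  have "\<phi> 0 = 0" by (simp add: \<phi>_def triod_maps_basic(2)[OF f])
  moreover have "norm q \<le> \<phi> (norm p)"
    using pq triod_ge_radius[of q "f p"] T p q by (simp add: \<phi>_def pu)
  \<comment> \<open>The image of \<open>s *\<^sub>R u\<close> is exactly \<open>q\<close>, so \<open>\<eta> s\<close> is controlled by \<open>f q\<close>.\<close>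
  ultimately obtain s where s: "0 \<le> s" "s \<le> norm p" "\<phi> s = norm q"
    using IVT'[of \<phi> 0 "norm q" "norm p"] np continuous_on_subset[OF \<phi>c] by auto
  have "s > 0" using s \<open>\<phi> 0 = 0\<close> nq by (metis less_eq_real_def less_irrefl)
  have "norm p \<le> \<eta> s"
    using qp triod_ge_radius[of p "f q"] T p q by (simp add: \<eta>_def s qv)
  moreover have "\<eta> 1 \<le> 1"
    unfolding \<eta>_def
    by (intro radius_along_le_1 T scaleR_direction_in_triod u v) (use \<phi>1[of 1] in auto)
  moreover have "continuous_on {s..1} (\<lambda>t. \<eta> t - t)"
    using s by (intro continuous_intros continuous_on_subset[OF \<eta>c]) auto
  ultimately obtain t where t: "s \<le> t" "t \<le> 1" "\<eta> t = t"
    using IVT2'[of "\<lambda>t. \<eta> t - t" 1 0 s] s np by auto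
  have t0: "t > 0" using t \<open>s > 0\<close> by simp
  have tT: "t *\<^sub>R u \<in> triod" using t t0 u scaleR_direction_in_triod by simp
  have \<phi>t: "\<phi> t > 0"
  proof (rule ccontr)
    assume "\<not> \<phi> t > 0"
    then have "\<phi> t = 0" using \<phi>1[of t] t t0 by simp
    then have "\<eta> t = 0" by (simp add: \<eta>_def triod_maps_basic(2)[OF f])
    then show False using t t0 by simp
  qed
  have fw: "f (t *\<^sub>R u) = \<phi> t *\<^sub>R v"
    using radius_along_pos_imp[of "f (t *\<^sub>R u)" v] T tT v \<phi>t by (simp add: \<phi>_def)
  have sT: "\<phi> t *\<^sub>R v \<in> triod" using \<phi>1[of t] t t0 v scaleR_direction_in_triod by simp
  have ffw: "f (\<phi> t *\<^sub>R v) = t *\<^sub>R u"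
    using radius_along_pos_imp[of "f (\<phi> t *\<^sub>R v)" u] T sT u t t0 by (simp add: \<eta>_def)
  show ?thesis
  proof (rule that[of "t *\<^sub>R u"])
    show "t *\<^sub>R u \<in> triod - {0}" "sgn (t *\<^sub>R u) = u"
      using tT t0 u by (auto simp: sgn_scaleR_direction)
    show "f (t *\<^sub>R u) \<in> triod - {0}" "sgn (f (t *\<^sub>R u)) = v"
      using fw sT \<phi>t v by (auto simp: sgn_scaleR_direction)
    show "f (f (t *\<^sub>R u)) = t *\<^sub>R u" using fw ffw by simp
  qed
qed

lemma two_cycle_in_cycles:
  assumes f: "f \<in> triod_maps" and w: "w \<in> triod - {0}" "f w \<in> triod - {0}" "f (f w) = w"
  shows "(f, {w, f w}) \<in> cycles"
proof -
  have "(f ^^ k) w \<in> {w, f w}" for k by (induction k) (use w in auto)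
  moreover have "w = (f ^^ 0) w" "f w = (f ^^ 1) w" by simp_all
  ultimately have "{w, f w} = range (\<lambda>k. (f ^^ k) w)" by blast
  moreover have "(f ^^ 2) w = w" using w by (simp add: numeral_2_eq_2)
  ultimately have "\<exists>x n. n > 0 \<and> (f ^^ n) x = x \<and> {w, f w} = range (\<lambda>k. (f ^^ k) x)"
    by (intro exI[of _ w] exI[of _ 2]) simp
  then show ?thesis unfolding cycles_def using f w(1,2) by simp
qed

section \<open>Equivalence of cycles\<close>

text \<open>The combinatorial content of the equivalence of cycles: a conjugacy that respects branches and the
  order on each branch.\<close>

definition cycle_iso ::
  "(complex \<Rightarrow> complex) \<Rightarrow> complex set \<Rightarrow> (complex \<Rightarrow> complex) \<Rightarrow> complex set \<Rightarrow> (complex \<Rightarrow> complex) \<Rightarrow> bool"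
  where "cycle_iso f P g Q h \<longleftrightarrow> bij_betw h P Q \<and> (\<forall>x\<in>P. sgn (h x) = sgn x \<and> h (f x) = g (h x)) \<and>
    (\<forall>x\<in>P. \<forall>y\<in>P. sgn x = sgn y \<longrightarrow> (norm x < norm y \<longleftrightarrow> norm (h x) < norm (h y)))"

lemma cycle_iso_sym:
  assumes "cycle_iso f P g Q h" "f ` P \<subseteq> P"
  obtains k where "cycle_iso g Q f P k"
proof -
  have b: "bij_betw h P Q" using assms by (simp add: cycle_iso_def)
  let ?k = "inv_into P h"
  have k: "bij_betw ?k Q P" using b bij_betw_inv_into by blast
  have kP: "?k y \<in> P" if "y \<in> Q" for y using k that bij_betwE by blast
  have hk: "h (?k y) = y" if "y \<in> Q" for y using b that by (simp add: bij_betw_inv_into_right)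
  have kh: "?k (h x) = x" if "x \<in> P" for x using b that by (simp add: bij_betw_inv_into_left)
  have "?k (g y) = f (?k y)" if "y \<in> Q" for y
  proof -
    have "g y = h (f (?k y))" using assms(1) kP[OF that] hk[OF that] by (auto simp: cycle_iso_def)
    then show ?thesis using kh kP[OF that] assms(2) by auto
  qed
  moreover have "sgn (?k y) = sgn y" if "y \<in> Q" for y
    using assms(1) kP[OF that] hk[OF that] by (metis cycle_iso_def)
  ultimately have "cycle_iso g Q f P ?k"
    unfolding cycle_iso_def using k assms(1) kP hk by (auto simp: cycle_iso_def)
  then show ?thesis using that by blast
qed

lemma cycle_iso_trans:
  assumes "cycle_iso f P g Q h" "cycle_iso g Q f' P' k"
  shows "cycle_iso f P f' P' (k \<circ> h)"
proof -
  have "\<And>x. x \<in> P \<Longrightarrow> h x \<in> Q" using assms(1) by (auto simp: cycle_iso_def bij_betw_def)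
  then show ?thesis
    using assms bij_betw_trans[of h P Q k P'] unfolding cycle_iso_def by auto
qed

text \<open>The point of a cycle closest to the branching point is mapped to another branch, since otherwise it
  would be moved outwards.\<close>

lemma cycle_two_branches:
  assumes c: "(f, P) \<in> cycles"
  obtains x y where "x \<in> P" "y \<in> P" "sgn x \<noteq> sgn y"
proof -
  note b = cycles_basic[OF c]
  obtain x where x: "x \<in> P" "\<forall>y\<in>P. norm x \<le> norm y"
    using ex_min_if_finite[of "norm ` P"] b(3,4) by (metis (no_types, lifting) empty_is_image
        finite_imageI imageE imageI linorder_not_le)
  have fx: "f x \<in> P" using x b by auto
  have "\<not> triod_ge (f x) x" using no_expanded_point b x by blast
  then have "sgn (f x) \<noteq> sgn x" using triod_ge_iff[of x "f x"] x fx b(2) by auto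
  then show ?thesis using that x fx by metis
qed

text \<open>A homeomorphism of the hulls that respects the branches fixes the branching point, so it is monotone on
  each branch: were the order of \<open>x < y\<close> not kept, some point of the segment from \<open>0\<close> to \<open>x\<close> would have
  the same image as \<open>y\<close>.\<close>

lemma cycle_equiv_imp_iso:
  assumes "((f, P), (g, Q)) \<in> cycle_equiv"
  shows "\<exists>h. cycle_iso f P g Q h"
proof -
  obtain h k where cP: "(f, P) \<in> cycles" and cQ: "(g, Q) \<in> cycles"
    and hom: "homeomorphism (triod_hull P) (triod_hull Q) h k"
    and hb: "\<forall>b\<in>branches. h ` (triod_hull P \<inter> b) = triod_hull Q \<inter> b"
    and hP: "h ` P = Q" and hf: "\<forall>x\<in>P. h (f x) = g (h x)"
    using assms by (auto simp: cycle_equiv_def)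
  note bP = cycles_basic[OF cP] and bQ = cycles_basic[OF cQ]
  obtain x y where "x \<in> P" "y \<in> P" "sgn x \<noteq> sgn y" using cycle_two_branches[OF cP] .
  note HP = triod_hull_eq[OF bP(3,2) this]
  obtain x' y' where "x' \<in> Q" "y' \<in> Q" "sgn x' \<noteq> sgn y'" using cycle_two_branches[OF cQ] .
  note HQ = triod_hull_eq[OF bQ(3,2) this]
  have inj: "inj_on h (triod_hull P)"
    using hom by (metis homeomorphism_apply1 inj_on_inverseI)
  have PH: "P \<subseteq> triod_hull P" unfolding triod_hull_def by blast
  have 0: "0 \<in> triod_hull P" "0 \<in> triod_hull Q"
  proof -
    obtain p q where "p \<in> P" "q \<in> Q" using bP(4) bQ(4) by blast
    moreover have "0 = 0 *\<^sub>R p" "0 = 0 *\<^sub>R q" "0 \<le> (0::real)" "(0::real) \<le> 1" by simp_all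
    ultimately show "0 \<in> triod_hull P" "0 \<in> triod_hull Q" unfolding HP HQ by blast+
  qed
  have sg: "sgn (h z) = sgn z \<and> h z \<in> triod - {0}" if "z \<in> triod_hull P" "z \<noteq> 0" "z \<in> triod" for z
  proof -
    have "sgn z ^ 3 = 1" "z \<in> branch (sgn z)" using that triod_iff by (auto simp: branch_def)
    then have "h z \<in> branch (sgn z)" using hb that unfolding branches_eq by blast
    then show ?thesis by (auto simp: branch_def)
  qed
  have h0: "h 0 = 0"
  proof (rule ccontr)
    assume "h 0 \<noteq> 0"
    have hH: "h 0 \<in> triod_hull Q" using hom 0 by (auto simp: homeomorphism_def)
    then obtain t q where "h 0 = t *\<^sub>R q" "0 \<le> t" "t \<le> 1" "q \<in> Q" unfolding HQ by auto
    then have "sgn (h 0) = sgn q" using \<open>h 0 \<noteq> 0\<close> by (auto simp: sgn_scaleR)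
    moreover have "norm (h 0) \<le> 1" using \<open>h 0 = _\<close> \<open>t \<le> 1\<close> \<open>0 \<le> t\<close> \<open>q \<in> Q\<close> bQ(2) triod_iff
      by (auto intro!: mult_le_one)
    ultimately have "h 0 \<in> branch (sgn q)" "sgn q ^ 3 = 1"
      using \<open>h 0 \<noteq> 0\<close> cycle_sgn_cube[OF cQ \<open>q \<in> Q\<close>] by (auto simp: branch_def triod_iff)
    then have "h 0 \<in> h ` (triod_hull P \<inter> branch (sgn q))"
      using hb hH unfolding branches_eq by blast
    then obtain z where "z \<in> triod_hull P" "z \<in> branch (sgn q)" "h 0 = h z" by blast
    then have "z = 0" using inj 0 by (metis inj_onD)
    then show False using \<open>z \<in> branch (sgn q)\<close> by (simp add: branch_def)
  qed
  have mono: "norm (h x) < norm (h y)" if xy: "x \<in> P" "y \<in> P" "sgn x = sgn y" "norm x < norm y" for x y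
  proof (rule ccontr)
    assume not: "\<not> norm (h x) < norm (h y)"
    define u where "u = sgn y"
    have u: "u ^ 3 = 1" using cycle_sgn_cube[OF cP xy(2)] by (simp add: u_def)
    have seg: "t *\<^sub>R x \<in> triod_hull P" "t *\<^sub>R x \<in> triod" if "0 \<le> t" "t \<le> 1" for t
    proof -
      show "t *\<^sub>R x \<in> triod_hull P" unfolding HP using that xy by auto
      show "t *\<^sub>R x \<in> triod" using that xy bP(2) scaleR_in_triod by blast
    qed
    have "continuous_on {0..1} (\<lambda>t. h (t *\<^sub>R x))"
      by (rule continuous_on_compose2[of "triod_hull P" h])
        (use hom seg in \<open>auto simp: homeomorphism_def intro!: continuous_intros\<close>)
    then have "continuous_on {0..1} (\<lambda>t. norm (h (t *\<^sub>R x)))" by (intro continuous_intros)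
    moreover have "norm (h (0 *\<^sub>R x)) \<le> norm (h y)" by (simp add: h0)
    ultimately obtain t where t: "0 \<le> t" "t \<le> 1" "norm (h (t *\<^sub>R x)) = norm (h y)"
      using IVT'[of "\<lambda>t. norm (h (t *\<^sub>R x))" 0 "norm (h y)" 1] not by auto
    have y: "y \<in> triod_hull P" "y \<noteq> 0" "y \<in> triod" using xy PH bP(2) by auto
    have "h y \<noteq> 0" using sg[OF y] by simp
    then have "t \<noteq> 0" using t h0 by auto
    then have "t *\<^sub>R x \<noteq> 0" "sgn (t *\<^sub>R x) = sgn x" using t xy bP(2) by (auto simp: sgn_scaleR)
    then have "sgn (h (t *\<^sub>R x)) = sgn (h y)" using sg[OF y] sg[of "t *\<^sub>R x"] seg t xy by auto
    then have "h (t *\<^sub>R x) = h y" using t same_direction_eq by blast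
    then have "t *\<^sub>R x = y" using inj seg t y by (metis inj_onD)
    moreover have "norm (t *\<^sub>R x) \<le> norm x" using t by (simp add: mult_left_le_one_le)
    ultimately show False using xy by simp
  qed
  have "norm x < norm y \<longleftrightarrow> norm (h x) < norm (h y)" if "x \<in> P" "y \<in> P" "sgn x = sgn y" for x y
    using mono[of x y] mono[of y x] that same_direction_eq
    by (metis linorder_less_linear order_less_asym)
  moreover have "bij_betw h P Q" using hP inj PH by (auto simp: bij_betw_def intro: inj_on_subset)
  ultimately have "cycle_iso f P g Q h"
    unfolding cycle_iso_def using sg hf PH bP(2) by blast
  then show ?thesis by blast
qed

text \<open>Primitive cycles of period \<open>2\<close> on the same two branches exhibit the same pattern: rescale the two
  branches linearly.\<close>

lemma two_cycles_equiv:
  assumes c: "(f, {a, b}) \<in> cycles" "(g, {a', b'}) \<in> cycles"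
    and f: "f a = b" "f b = a" and g: "g a' = b'" "g b' = a'"
    and s: "sgn a' = sgn a" "sgn b' = sgn b" "sgn a \<noteq> sgn b"
  shows "((f, {a, b}), (g, {a', b'})) \<in> cycle_equiv"
proof -
  have T: "a \<in> triod - {0}" "b \<in> triod - {0}" "a' \<in> triod - {0}" "b' \<in> triod - {0}"
    using cycles_basic(2)[OF c(1)] cycles_basic(2)[OF c(2)] by auto
  define stretch where "stretch c d c' d' z =
      (radius_along (sgn c) z / norm c) *\<^sub>R c' + (radius_along (sgn d) z / norm d) *\<^sub>R d'"
    for c d c' d' z :: complex
  define H where "H c d = {t *\<^sub>R p | t p. 0 \<le> t \<and> t \<le> 1 \<and> p \<in> {c, d}}" for c d :: complex
  have hull: "triod_hull {c, d} = H c d"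
    if "c \<in> triod - {0}" "d \<in> triod - {0}" "sgn c \<noteq> sgn d" for c d
    using triod_hull_eq[of "{c, d}" c d] that by (simp add: H_def)
  have str: "stretch c d c' d' (t *\<^sub>R c) = t *\<^sub>R c'" "stretch c d c' d' (t *\<^sub>R d) = t *\<^sub>R d'"
    if "c \<in> triod - {0}" "d \<in> triod - {0}" "sgn c \<noteq> sgn d" "0 \<le> t" "t \<le> 1" for c d c' d' t
  proof -
    have cd: "sgn c ^ 3 = 1" "sgn d ^ 3 = 1" using that triod_iff by auto
    have tT: "t *\<^sub>R c \<in> triod" "t *\<^sub>R d \<in> triod"
      using that scaleR_in_triod by blast+
    show "stretch c d c' d' (t *\<^sub>R c) = t *\<^sub>R c'" "stretch c d c' d' (t *\<^sub>R d) = t *\<^sub>R d'"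
      using that cd tT
      by (cases "t = 0"; auto simp: stretch_def radius_along_eq sgn_scaleR)+
  qed
  have maps: "stretch c d c' d' ` H c d \<subseteq> H c' d'"
    if "c \<in> triod - {0}" "d \<in> triod - {0}" "sgn c \<noteq> sgn d" for c d c' d'
    using str[OF that] by (auto simp: H_def) blast+
  have inv: "stretch c' d' c d (stretch c d c' d' z) = z"
    if "c \<in> triod - {0}" "d \<in> triod - {0}" "sgn c \<noteq> sgn d"
      "c' \<in> triod - {0}" "d' \<in> triod - {0}" "sgn c' \<noteq> sgn d'" "z \<in> H c d" for c d c' d' z
    using that str[OF that(1-3)] str[OF that(4-6)] by (auto simp: H_def)
  have cont: "continuous_on S (stretch c d c' d')" for S c d c' d'
  proof -
    have "continuous_on S (\<lambda>z. (radius_along u z / k) *\<^sub>R w)" for u k and w :: complex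
      by (cases "k = 0") (auto intro!: continuous_intros)
    then show ?thesis unfolding stretch_def by (intro continuous_on_add)
  qed
  let ?h = "stretch a b a' b'" and ?k = "stretch a' b' a b"
  have s': "sgn a' \<noteq> sgn b'" using s by simp
  have hom: "homeomorphism (H a b) (H a' b') ?h ?k"
    by (rule homeomorphismI[OF cont cont maps[OF T(1,2) s(3)] maps[OF T(3,4) s']
          inv[OF T(1,2) s(3) T(3,4) s'] inv[OF T(3,4) s' T(1,2) s(3)]])
  have sg: "sgn (stretch c d c' d' z) = sgn z"
    if "c \<in> triod - {0}" "d \<in> triod - {0}" "sgn c \<noteq> sgn d" "sgn c' = sgn c" "sgn d' = sgn d"
      "z \<in> H c d" for c d c' d' z
    using that str[OF that(1-3)] by (auto simp: H_def sgn_scaleR)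
  have HT: "H c d \<subseteq> triod" if "c \<in> triod - {0}" "d \<in> triod - {0}" for c d
  proof
    fix z assume "z \<in> H c d"
    then obtain t p where tp: "z = t *\<^sub>R p" "0 \<le> t" "t \<le> 1" "p \<in> {c, d}" by (auto simp: H_def)
    then show "z \<in> triod" using that scaleR_in_triod by blast
  qed
  have img: "stretch c d c' d' ` (H c d \<inter> branch u) \<subseteq> H c' d' \<inter> branch u"
    if "c \<in> triod - {0}" "d \<in> triod - {0}" "sgn c \<noteq> sgn d" "sgn c' = sgn c" "sgn d' = sgn d"
       "c' \<in> triod - {0}" "d' \<in> triod - {0}" for c d c' d' u
  proof clarify
    fix z assume z: "z \<in> H c d" "z \<in> branch u"
    have "stretch c d c' d' z \<in> H c' d'" using maps[OF that(1-3)] z by blast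
    moreover have "sgn (stretch c d c' d' z) = u" using sg[OF that(1-5) z(1)] z by (simp add: branch_def)
    moreover have "u \<noteq> 0" using z by (auto simp: branch_def sgn_zero_iff)
    ultimately show "stretch c d c' d' z \<in> H c' d' \<inter> branch u"
      using HT[OF that(6,7)] by (auto simp: branch_def)
  qed
  have br: "?h ` (H a b \<inter> branch u) = H a' b' \<inter> branch u" for u
  proof
    show "?h ` (H a b \<inter> branch u) \<subseteq> H a' b' \<inter> branch u" using img T s by auto
    show "H a' b' \<inter> branch u \<subseteq> ?h ` (H a b \<inter> branch u)"
    proof
      fix z assume z: "z \<in> H a' b' \<inter> branch u"
      then have "?k z \<in> H a b \<inter> branch u" using img[OF T(3,4) s' s(1,2)[symmetric] T(1,2), of u] by blast
      moreover have "?h (?k z) = z" using inv[OF T(3,4) s' T(1,2) s(3)] z by blast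
      ultimately show "z \<in> ?h ` (H a b \<inter> branch u)" by (metis imageI)
    qed
  qed
  have ab: "?h a = a'" "?h b = b'" using str[OF T(1,2) s(3), of 1 a' b'] by simp_all
  have "homeomorphism (triod_hull {a, b}) (triod_hull {a', b'}) ?h ?k \<and>
    (\<forall>B\<in>branches. ?h ` (triod_hull {a, b} \<inter> B) = triod_hull {a', b'} \<inter> B) \<and>
    ?h ` {a, b} = {a', b'} \<and> (\<forall>x\<in>{a, b}. ?h (f x) = g (?h x))"
    unfolding hull[OF T(1,2) s(3)] hull[OF T(3,4) s'] branches_eq
    using hom br ab f g by simp
  then show ?thesis unfolding cycle_equiv_def using c by blast
qed

lemma pattern_members:
  assumes "\<pi> \<in> patterns" "c \<in> \<pi>" "c' \<in> \<pi>"
  obtains h where "c \<in> cycles" "c' \<in> cycles" "cycle_iso (fst c) (snd c) (fst c') (snd c') h"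
proof -
  obtain c0 where c0: "\<pi> = cycle_equiv `` {c0}" using assms(1) by (auto simp: patterns_def quotient_def)
  then have e: "(c0, c) \<in> cycle_equiv" "(c0, c') \<in> cycle_equiv" using assms by auto
  then have cyc: "c0 \<in> cycles" "c \<in> cycles" "c' \<in> cycles" by (auto simp: cycle_equiv_def)
  obtain h where h: "cycle_iso (fst c0) (snd c0) (fst c) (snd c) h"
    using e cycle_equiv_imp_iso by (metis prod.collapse)
  obtain k where k: "cycle_iso (fst c0) (snd c0) (fst c') (snd c') k"
    using e cycle_equiv_imp_iso by (metis prod.collapse)
  have "fst c0 ` snd c0 \<subseteq> snd c0" using cycles_basic(5) cyc(1) by (metis prod.collapse)
  then obtain h' where "cycle_iso (fst c) (snd c) (fst c0) (snd c0) h'"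
    using cycle_iso_sym[OF h] by blast
  then show ?thesis using that cyc cycle_iso_trans k by blast
qed

section \<open>Canonical ordering\<close>

definition nearest :: "complex set \<Rightarrow> complex \<Rightarrow> bool" where
  "nearest P p \<longleftrightarrow> p \<in> P \<and> (\<forall>q\<in>P. sgn q = sgn p \<longrightarrow> norm p \<le> norm q)"

lemma cycle_iso_nearest:
  assumes "cycle_iso f P g Q h" "nearest P p"
  shows "nearest Q (h p)"
proof -
  have "Q = h ` P" using assms(1) by (simp add: cycle_iso_def bij_betw_def)
  then show ?thesis using assms unfolding nearest_def cycle_iso_def
    by (auto simp: not_less[symmetric])
qed

lemma nearest_exists:
  assumes "finite P" "x \<in> P"
  obtains p where "nearest P p" "sgn p = sgn x"
proof -
  let ?S = "{q \<in> P. sgn q = sgn x}"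
  have "finite ?S" "?S \<noteq> {}" using assms by auto
  then obtain p where "p \<in> ?S" "\<forall>q\<in>?S. norm p \<le> norm q"
    using ex_is_arg_min_if_finite[of ?S norm] by (auto simp: is_arg_min_def not_less)
  then show ?thesis using that by (auto simp: nearest_def)
qed

text \<open>If the points nearest to \<open>0\<close> on two branches are mapped to each other's branches, then so are those of
  every cycle with the same pattern. The map then has a primitive cycle of period \<open>2\<close> on these two branches, and
  all such cycles have one pattern.\<close>

lemma regular_no_exchange:
  assumes reg: "regular_pattern \<pi>" and fP: "(f, P) \<in> \<pi>"
    and p: "nearest P p" and q: "nearest P q" and pq: "sgn (f p) = sgn q" and qp: "sgn (f q) = sgn p"
  shows False
proof -
  have pat: "\<pi> \<in> patterns" using reg by (simp add: regular_pattern_def)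
  have key: "\<exists>w. (g, {w, g w}) \<in> cycles \<and> g (g w) = w \<and> sgn w = sgn p \<and> sgn (g w) = sgn q \<and>
      sgn p \<noteq> sgn q"
    if gQ: "(g, Q) \<in> \<pi>" for g Q
  proof -
    obtain h where h: "(f, P) \<in> cycles" "(g, Q) \<in> cycles" "cycle_iso f P g Q h"
      using pattern_members[OF pat fP gQ] by auto
    note b = cycles_basic[OF h(2)]
    have PP: "p \<in> P" "q \<in> P" using p q by (auto simp: nearest_def)
    have fPP: "f p \<in> P" "f q \<in> P" using PP cycles_basic(5)[OF h(1)] by auto
    let ?p = "h p" and ?q = "h q"
    have near: "nearest Q ?p" "nearest Q ?q" using cycle_iso_nearest h p q by blast+
    have sg: "sgn ?p = sgn p" "sgn ?q = sgn q" "sgn (g ?p) = sgn q" "sgn (g ?q) = sgn p"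
      using h(3) PP fPP pq qp unfolding cycle_iso_def by metis+
    have Q: "?p \<in> Q" "?q \<in> Q" "g ?p \<in> Q" "g ?q \<in> Q" using near b(5) by (auto simp: nearest_def)
    have ge: "triod_ge (g ?p) ?q" "triod_ge (g ?q) ?p"
    proof -
      have n: "norm ?q \<le> norm (g ?p)" "norm ?p \<le> norm (g ?q)"
        using near sg Q unfolding nearest_def by metis+
      have T: "?p \<in> triod - {0}" "?q \<in> triod - {0}" "g ?p \<in> triod - {0}" "g ?q \<in> triod - {0}"
        using Q b(2) by blast+
      show "triod_ge (g ?p) ?q" "triod_ge (g ?q) ?p"
        using n sg T triod_ge_iff[OF T(1)] triod_ge_iff[OF T(2)] by simp_all
    qed
    have ne: "sgn p \<noteq> sgn q"
    proof
      assume e: "sgn p = sgn q"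
      have "?p = ?q" using near sg e same_direction_eq Q
        by (metis nearest_def order_antisym)
      then show False using ge no_expanded_point b Q by (metis subsetD)
    qed
    obtain w where "w \<in> triod - {0}" "g w \<in> triod - {0}" "g (g w) = w" "sgn w = sgn p" "sgn (g w) = sgn q"
    proof (rule two_cycle_exists[OF b(1), of "sgn p" "sgn q" ?p ?q])
      show "sgn p ^ 3 = 1" "sgn q ^ 3 = 1" using cycle_sgn_cube h(1) PP by blast+
    qed (use ge sg Q b(2) ne in auto)
    then show ?thesis using two_cycle_in_cycles[OF b(1)] ne by blast
  qed
  obtain w where w: "(f, {w, f w}) \<in> cycles" "f (f w) = w" "sgn w = sgn p" "sgn (f w) = sgn q"
    "sgn p \<noteq> sgn q" using key[OF fP] by blast
  define B where "B = cycle_equiv `` {(f, {w, f w})}"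
  have "B \<in> patterns" unfolding B_def patterns_def using w(1) by (rule quotientI)
  moreover have "(f, {w, f w}) \<in> B"
    unfolding B_def using two_cycles_equiv[OF w(1) w(1)] w by auto
  moreover have "primitive_cycle {w, f w}"
    using w by (auto simp: primitive_cycle_def same_branch_iff)
  moreover have "w \<noteq> f w" using w by metis
  then have "card {w, f w} = 2" by simp
  moreover have "forces \<pi> B" unfolding forces_def
  proof (intro ballI impI)
    fix g assume "g \<in> triod_maps" "\<exists>Q. (g, Q) \<in> \<pi>"
    then obtain w' where w': "(g, {w', g w'}) \<in> cycles" "g (g w') = w'" "sgn w' = sgn p"
      "sgn (g w') = sgn q" using key by blast
    then have "(g, {w', g w'}) \<in> B"
      unfolding B_def using two_cycles_equiv[OF w(1) w'(1)] w by auto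
    then show "\<exists>Q. (g, Q) \<in> B" by blast
  qed
  ultimately show False using reg unfolding regular_pattern_def by blast
qed

lemma branch_eq_iff: "u ^ 3 = 1 \<Longrightarrow> v ^ 3 = 1 \<Longrightarrow> branch u = branch v \<longleftrightarrow> u = v"
proof
  assume u: "u ^ 3 = 1" and e: "branch u = branch v"
  have m: "u \<in> branch u" using branch_nonempty[OF u] .
  then have "sgn u = v" unfolding e by (simp add: branch_def)
  moreover have "sgn u = u" using m by (simp add: branch_def)
  ultimately show "u = v" by simp
qed simp

text \<open>Sending the direction of a nearest point to the direction of its image gives a map of the directions
  present in \<open>P\<close> without fixed points, and for a regular pattern without cycles of length \<open>2\<close>. With only three
  directions it has to be a cyclic permutation of all of them.\<close>

lemma regular_all_directions:
  assumes reg: "regular_pattern \<pi>" and fP: "(f, P) \<in> \<pi>"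
  obtains p where "\<And>i. i < (3::nat) \<Longrightarrow> nearest P (p i)" "\<And>i. i < 3 \<Longrightarrow> sgn (f (p i)) = sgn (p (Suc i mod 3))"
    "bij_betw (\<lambda>i. sgn (p i)) {..<3} directions"
proof -
  have c: "(f, P) \<in> cycles"
    using pattern_members[OF _ fP fP] reg by (auto simp: regular_pattern_def)
  note b = cycles_basic[OF c]
  have step: "\<exists>p'. nearest P p' \<and> sgn p' = sgn (f p) \<and> sgn p' \<noteq> sgn p" if p: "nearest P p" for p
  proof -
    have pP: "p \<in> P" "f p \<in> P" using p b(5) by (auto simp: nearest_def)
    obtain p' where p': "nearest P p'" "sgn p' = sgn (f p)" using nearest_exists[OF b(3) pP(2)] .
    have "sgn (f p) \<noteq> sgn p"
      using no_expanded_point[OF b(1), of p] triod_ge_iff[of p "f p"] p pP b(2)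
      by (auto simp: nearest_def)
    then show ?thesis using p' by auto
  qed
  obtain x where "x \<in> P" using b(4) by auto
  then obtain p0 where p0: "nearest P p0" using nearest_exists[OF b(3)] by metis
  obtain p1 where p1: "nearest P p1" "sgn p1 = sgn (f p0)" "sgn p1 \<noteq> sgn p0" using step[OF p0] by blast
  obtain p2 where p2: "nearest P p2" "sgn p2 = sgn (f p1)" "sgn p2 \<noteq> sgn p1" using step[OF p1(1)] by blast
  have "sgn p2 \<noteq> sgn p0" using regular_no_exchange[OF reg fP p0 p1(1)] p1 p2 by auto
  obtain p3 where p3: "nearest P p3" "sgn p3 = sgn (f p2)" "sgn p3 \<noteq> sgn p2" using step[OF p2(1)] by blast
  have n1: "sgn p3 \<noteq> sgn p1" using regular_no_exchange[OF reg fP p1(1) p2(1)] p2 p3 by auto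
  have dirs: "{sgn p0, sgn p1, sgn p2} \<subseteq> directions" "sgn p3 \<in> directions"
  proof -
    have "p0 \<in> P" "p1 \<in> P" "p2 \<in> P" "p3 \<in> P"
      using p0 p1(1) p2(1) p3(1) by (simp_all only: nearest_def)
    then show "{sgn p0, sgn p1, sgn p2} \<subseteq> directions" "sgn p3 \<in> directions"
      using cycle_sgn_cube[OF c] by simp_all
  qed
  have "card {sgn p0, sgn p1, sgn p2} = 3" using p1 p2 \<open>sgn p2 \<noteq> sgn p0\<close> by auto
  then have all: "{sgn p0, sgn p1, sgn p2} = directions"
    using dirs card_subset_eq[OF finite_directions dirs(1)] card_directions by simp
  then have "sgn p3 = sgn p0" using dirs(2) n1 p3 by auto
  define p where "p i = (if i = 0 then p0 else if i = 1 then p1 else p2)" for i :: nat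
  have lt3: "i < 3 \<longleftrightarrow> i = 0 \<or> i = 1 \<or> i = 2" for i :: nat by auto
  have r3: "{..<3} = {0, 1, 2::nat}" by auto
  show ?thesis
  proof (rule that[of p])
    show "nearest P (p i)" if "i < 3" for i using p0 p1 p2 by (simp add: p_def)
    show "sgn (f (p i)) = sgn (p (Suc i mod 3))" if "i < 3" for i
      using that p1 p2 p3 \<open>sgn p3 = sgn p0\<close> unfolding lt3 by (auto simp: p_def)
    show "bij_betw (\<lambda>i. sgn (p i)) {..<3} directions"
      unfolding bij_betw_def r3 using p1 p2 \<open>sgn p2 \<noteq> sgn p0\<close> all by (auto simp: p_def)
  qed
qed

lemma canonical_ordering_exists:
  assumes reg: "regular_pattern \<pi>" and fP: "(f, P) \<in> \<pi>"
  shows "is_canonical_ordering f P (canonical_ordering f P)"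
proof -
  have c: "(f, P) \<in> cycles"
    using pattern_members[OF _ fP fP] reg by (auto simp: regular_pattern_def)
  note b = cycles_basic[OF c]
  obtain p where p: "\<And>i. i < (3::nat) \<Longrightarrow> nearest P (p i)"
    "\<And>i. i < 3 \<Longrightarrow> sgn (f (p i)) = sgn (p (Suc i mod 3))"
    "bij_betw (\<lambda>i. sgn (p i)) {..<3} directions"
    using regular_all_directions[OF reg fP] by blast
  have "inj_on branch directions" by (auto intro!: inj_onI simp: branch_eq_iff)
  then have bb: "bij_betw branch directions branches" by (simp add: bij_betw_def branches_eq)
  have "is_canonical_ordering f P (\<lambda>i. branch (sgn (p i)))"
    unfolding is_canonical_ordering_def
  proof (intro conjI allI impI)
    show "bij_betw (\<lambda>i. branch (sgn (p i))) {..<3} branches"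
      using bij_betw_trans[OF p(3) bb] by (simp add: comp_def)
    fix i :: nat assume i: "i < 3"
    have "p i \<in> P \<inter> branch (sgn (p i))" "\<forall>q\<in>P \<inter> branch (sgn (p i)). dist 0 (p i) \<le> dist 0 q"
      using p(1)[OF i] b(2) by (auto simp: nearest_def branch_def)
    moreover have "f (p i) \<in> branch (sgn (p ((i + 1) mod 3)))"
      using p(1)[OF i] p(2)[OF i] b by (auto simp: nearest_def branch_def)
    ultimately show "\<exists>pa\<in>P \<inter> branch (sgn (p i)). (\<forall>q\<in>P \<inter> branch (sgn (p i)). dist 0 pa \<le> dist 0 q) \<and>
          f pa \<in> branch (sgn (p ((i + 1) mod 3)))" by blast
  qed
  then show ?thesis unfolding canonical_ordering_def
    by (rule someI[of "is_canonical_ordering f P"])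
qed

lemma cycle_iso_canonical_ordering_imp:
  assumes iso: "cycle_iso f P g Q h" and c: "(f, P) \<in> cycles" "(g, Q) \<in> cycles"
    and o: "is_canonical_ordering f P b"
  shows "is_canonical_ordering g Q b"
  unfolding is_canonical_ordering_def
proof (intro conjI allI impI)
  show bij: "bij_betw b {..<3} branches" using o by (simp add: is_canonical_ordering_def)
  fix i :: nat assume i: "i < 3"
  obtain p where p: "p \<in> P \<inter> b i" "\<forall>q\<in>P \<inter> b i. dist 0 p \<le> dist 0 q" "f p \<in> b ((i + 1) mod 3)"
    using o i by (auto simp: is_canonical_ordering_def)
  have br: "\<exists>u. b j = branch u" if "j < 3" for j
    using bij_betwE[OF bij] that unfolding branches_eq by blast
  obtain u where u: "b i = branch u" using br i by blast
  obtain v where v: "b ((i + 1) mod 3) = branch v" using br[of "(i + 1) mod 3"] by auto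
  have "nearest P p" using p u cycles_basic(2)[OF c(1)] by (auto simp: nearest_def branch_def)
  then have near: "nearest Q (h p)" using cycle_iso_nearest iso by blast
  have P: "p \<in> P" "f p \<in> P" using p cycles_basic(5)[OF c(1)] by auto
  have "sgn (h p) = sgn p" "sgn (g (h p)) = sgn (f p)"
    using iso P unfolding cycle_iso_def by metis+
  then have sg: "sgn (h p) = u" "sgn (g (h p)) = v"
    using p u v by (auto simp: branch_def)
  have "h p \<in> Q \<inter> b i" "\<forall>q\<in>Q \<inter> b i. dist 0 (h p) \<le> dist 0 q"
    using near sg u cycles_basic(2)[OF c(2)] by (auto simp: nearest_def branch_def)
  moreover have "g (h p) \<in> b ((i + 1) mod 3)"
    using near sg v cycles_basic(2,5)[OF c(2)] by (auto simp: nearest_def branch_def)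
  ultimately show "\<exists>p\<in>Q \<inter> b i. (\<forall>q\<in>Q \<inter> b i. dist 0 p \<le> dist 0 q) \<and> g p \<in> b ((i + 1) mod 3)"
    by blast
qed

text \<open>Isomorphic cycles have literally the same canonical orderings, so they also get the same one by choice.\<close>

lemma cycle_iso_displacement_eq:
  assumes iso: "cycle_iso f P g Q h" and c: "(f, P) \<in> cycles" "(g, Q) \<in> cycles"
  shows "displacement g Q = displacement f P"
proof -
  obtain k where k: "cycle_iso g Q f P k" using cycle_iso_sym[OF iso] cycles_basic(5)[OF c(1)] by blast
  have "is_canonical_ordering f P = is_canonical_ordering g Q"
    using cycle_iso_canonical_ordering_imp[OF iso c] cycle_iso_canonical_ordering_imp[OF k c(2) c(1)]
    by blast
  then show ?thesis by (simp add: displacement_def canonical_ordering_def fun_eq_iff)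
qed

section \<open>Linear maps\<close>

lemma arc_dist_commute: "arc_dist x y = arc_dist y x"
  by (auto simp: arc_dist_def same_branch_def dist_commute)

lemma continuous_on_arc_dist:
  assumes "continuous_on S k" "k ` S \<subseteq> triod" "w \<in> triod"
  shows "continuous_on S (\<lambda>s. arc_dist (k s) w)"
proof -
  have "continuous_on S (\<lambda>s. \<Sum>u\<in>directions. \<bar>radius_along u (k s) - radius_along u w\<bar>)"
    by (intro continuous_intros assms)
  then show ?thesis
    by (rule continuous_on_eq) (use assms arc_dist_radius in \<open>auto simp: image_subset_iff\<close>)
qed

definition consecutive :: "real set \<Rightarrow> real \<Rightarrow> real \<Rightarrow> bool" where
  "consecutive S a b \<longleftrightarrow> a \<in> S \<and> b \<in> S \<and> a < b \<and> {a<..<b} \<inter> S = {}"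

lemma consecutive_exists:
  assumes "finite S" "a \<in> S" "b \<in> S" "a < t" "t < b" "t \<notin> S"
  obtains s1 s2 where "consecutive S s1 s2" "s1 < t" "t < s2"
proof -
  let ?A = "{s \<in> S. s < t}" and ?B = "{s \<in> S. t < s}"
  have A: "finite ?A" "?A \<noteq> {}" and B: "finite ?B" "?B \<noteq> {}" using assms by auto
  have m: "Max ?A \<in> ?A" "Min ?B \<in> ?B" using Max_in[OF A] Min_in[OF B] by auto
  have "s \<notin> S" if "Max ?A < s" "s < Min ?B" for s
  proof
    assume "s \<in> S"
    then consider "s \<in> ?A" | "s \<in> ?B" using assms(6) by (metis linorder_neqE mem_Collect_eq)
    then show False
    proof cases
      case 1
      then show False using Max_ge[OF A(1) 1] that(1) by linarith
    next
      case 2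
      then show False using Min_le[OF B(1) 2] that(2) by linarith
    qed
  qed
  then have gap: "{Max ?A<..<Min ?B} \<inter> S = {}"
    unfolding disjoint_iff greaterThanLessThan_iff by metis
  have mm: "Max ?A \<in> S" "Max ?A < t" "Min ?B \<in> S" "t < Min ?B" using m by blast+
  then have "consecutive S (Max ?A) (Min ?B)"
    unfolding consecutive_def using gap less_trans by blast
  then show ?thesis using that mm by blast
qed

text \<open>Induction on the nodes from left to right: at each new largest node the constant tail is
  replaced by a geodesic.\<close>

lemma piecewise_geodesic_exists:
  fixes \<phi> :: "real \<Rightarrow> complex"
  assumes "finite S" "\<phi> ` S \<subseteq> triod"
  shows "\<exists>g. continuous_on UNIV g \<and> range g \<subseteq> triod \<and> (\<forall>s\<in>S. g s = \<phi> s) \<and>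
    (\<forall>a b. consecutive S a b \<longrightarrow>
       (\<exists>c\<ge>0. \<forall>s\<in>{a..b}. \<forall>t\<in>{a..b}. arc_dist (g s) (g t) = c * \<bar>s - t\<bar>)) \<and>
    (\<forall>s\<in>S. (\<forall>s'\<in>S. s' \<le> s) \<longrightarrow> (\<forall>t\<ge>s. g t = \<phi> s))"
  using assms
proof (induction rule: finite_linorder_max_induct)
  case empty
  show ?case by (intro exI[of _ "\<lambda>_. 0"]) (auto simp: consecutive_def)
next
  case (insert b A)
  show ?case
  proof (cases "A = {}")
    case True
    then show ?thesis using insert.prems
      by (intro exI[of _ "\<lambda>_. \<phi> b"]) (auto simp: consecutive_def)
  next
    case False
    obtain g where gc: "continuous_on UNIV g" and gT: "range g \<subseteq> triod"
      and g\<phi>: "\<forall>s\<in>A. g s = \<phi> s"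
      and ggap: "\<And>a b. consecutive A a b \<Longrightarrow>
        \<exists>c\<ge>0. \<forall>s\<in>{a..b}. \<forall>t\<in>{a..b}. arc_dist (g s) (g t) = c * \<bar>s - t\<bar>"
      using insert by auto
    define m where "m = Max A"
    have m: "m \<in> A" "\<And>s. s \<in> A \<Longrightarrow> s \<le> m"
      using False insert.hyps(1) by (auto simp: m_def)
    have mb: "m < b" using m insert.hyps by auto
    have T: "\<phi> m \<in> triod" "\<phi> b \<in> triod" using m insert.prems by auto
    obtain \<gamma> :: "real \<Rightarrow> complex" where \<gamma>c: "continuous_on UNIV \<gamma>" and \<gamma>0: "\<gamma> 0 = \<phi> m" and \<gamma>1: "\<gamma> 1 = \<phi> b"
      and \<gamma>T: "\<And>s. 0 \<le> s \<Longrightarrow> s \<le> 1 \<Longrightarrow> \<gamma> s \<in> triod"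
      and \<gamma>d: "\<And>s t. 0 \<le> s \<Longrightarrow> s \<le> 1 \<Longrightarrow> 0 \<le> t \<Longrightarrow> t \<le> 1 \<Longrightarrow>
         arc_dist (\<gamma> s) (\<gamma> t) = arc_dist (\<phi> m) (\<phi> b) * \<bar>s - t\<bar>"
      using geodesic_exists[OF T] by metis
    define r where "r t = min 1 ((t - m) / (b - m))" for t
    define g' where "g' t = (if t \<le> m then g t else \<gamma> (r t))" for t
    have rc: "continuous_on S r" for S unfolding r_def using mb by (intro continuous_intros) auto
    have r0: "r m = 0" and r1: "t \<ge> b \<Longrightarrow> r t = 1" for t
      using mb by (auto simp: r_def min_def field_simps)
    have r01: "0 \<le> r t \<and> r t \<le> 1" if "m \<le> t" for t using that mb by (auto simp: r_def)
    have req: "r t = (t - m) / (b - m)" if "t \<le> b" for t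
      using that mb by (auto simp: r_def min_def field_simps)
    have above: "g' t = \<gamma> (r t)" if "m \<le> t" for t
      using that g\<phi> m \<gamma>0 r0 by (cases "t = m") (auto simp: g'_def)
    have "continuous_on UNIV g'" unfolding g'_def
    proof (rule continuous_on_cases_le)
      show "continuous_on {t \<in> UNIV. t \<le> m} g" using gc continuous_on_subset by blast
      show "continuous_on {t \<in> UNIV. m \<le> t} (\<lambda>t. \<gamma> (r t))"
        by (rule continuous_on_compose2[OF \<gamma>c rc]) auto
      show "g t = \<gamma> (r t)" if "t = m" for t using that g\<phi> m \<gamma>0 r0 by auto
    qed (intro continuous_intros)
    moreover have "range g' \<subseteq> triod" using gT \<gamma>T r01 by (auto simp: g'_def image_subset_iff)
    moreover have "g' s = \<phi> s" if "s \<in> insert b A" for s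
      using that m g\<phi> r1 \<gamma>1 mb by (auto simp: g'_def)
    moreover have "\<exists>c\<ge>0. \<forall>s\<in>{s1..s2}. \<forall>t\<in>{s1..s2}. arc_dist (g' s) (g' t) = c * \<bar>s - t\<bar>"
      if con: "consecutive (insert b A) s1 s2" for s1 s2
    proof (cases "s2 = b")
      case True
      have "s1 \<in> A" using con True by (auto simp: consecutive_def)
      have "m \<notin> {s1<..<b}" using con True m by (auto simp: consecutive_def)
      then have "s1 = m" using m(2)[OF \<open>s1 \<in> A\<close>] mb by auto
      have "arc_dist (g' s) (g' t) = arc_dist (\<phi> m) (\<phi> b) / (b - m) * \<bar>s - t\<bar>"
        if "s \<in> {m..b}" "t \<in> {m..b}" for s t
      proof -
        have "arc_dist (g' s) (g' t) = arc_dist (\<phi> m) (\<phi> b) * \<bar>r s - r t\<bar>"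
          using that r01 above \<gamma>d by simp
        moreover have "r s - r t = (s - t) / (b - m)"
          using that by (simp add: req diff_divide_distrib [symmetric])
        ultimately show ?thesis using mb by simp
      qed
      moreover have "arc_dist (\<phi> m) (\<phi> b) / (b - m) \<ge> 0"
        using mb by (auto simp: arc_dist_def)
      ultimately show ?thesis using True \<open>s1 = m\<close> by blast
    next
      case False
      then have s: "s2 \<in> A" "s2 \<le> m" "s1 < s2" using con m by (auto simp: consecutive_def)
      then have "consecutive A s1 s2" using con mb by (auto simp: consecutive_def)
      then show ?thesis using ggap s by (auto simp: g'_def)
    qed
    moreover have "g' t = \<phi> s" if "s \<in> insert b A" "\<forall>s'\<in>insert b A. s' \<le> s" "t \<ge> s" for s t
    proof -
      have "s = b" using that insert.hyps(2) by force
      then show ?thesis using that r1[of t] \<gamma>1 mb above[of t] by auto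
    qed
    ultimately show ?thesis by (intro exI[of _ g'] conjI ballI allI impI)
  qed
qed

text \<open>The branching point counts as a node of every branch, because a linear map is pinned there.\<close>

definition nodes :: "complex set \<Rightarrow> complex \<Rightarrow> real set" where
  "nodes P u = insert 0 (norm ` {p \<in> P. sgn p = u})"

lemma nodes_basic:
  assumes "s \<in> nodes P u"
  shows "s *\<^sub>R u \<in> insert 0 P" "0 \<le> s" "s \<noteq> 0 \<Longrightarrow> s *\<^sub>R u \<in> P"
proof -
  show "s *\<^sub>R u \<in> insert 0 P" "0 \<le> s" using assms by (auto simp: nodes_def norm_scaleR_sgn)
  show "s *\<^sub>R u \<in> P" if "s \<noteq> 0"
    using assms that by (auto simp: nodes_def norm_scaleR_sgn)
qed

lemma finite_nodes: "finite P \<Longrightarrow> finite (nodes P u)"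
  by (simp add: nodes_def)

lemma nodes_nonempty: "nodes P u \<noteq> {}"
  by (simp add: nodes_def)

lemma norm_in_nodes: "p \<in> P \<Longrightarrow> norm p \<in> nodes P (sgn p)"
  by (auto simp: nodes_def)

definition geodesic_on_gaps :: "complex set \<Rightarrow> (complex \<Rightarrow> complex) \<Rightarrow> bool" where
  "geodesic_on_gaps P g \<longleftrightarrow> (\<forall>u\<in>directions. \<forall>a b. consecutive (nodes P u) a b \<longrightarrow>
     (\<exists>c\<ge>0. \<forall>s\<in>{a..b}. \<forall>t\<in>{a..b}. arc_dist (g (s *\<^sub>R u)) (g (t *\<^sub>R u)) = c * \<bar>s - t\<bar>))"

text \<open>The reason why a linear map creates no arrows of its own: a value between two adjacent nodes lies on
  the geodesic joining the images of these nodes, so one of the images is at least as far out. That node is not the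
  branching point, whose image \<open>0\<close> lies on no branch.\<close>

lemma gap_covering:
  assumes c: "(f, P) \<in> cycles" and g: "g ` triod \<subseteq> triod" "\<And>x. x \<in> insert 0 P \<Longrightarrow> g x = f x"
    and gaps: "geodesic_on_gaps P g" and u: "u ^ 3 = 1"
    and ab: "consecutive (nodes P u) a b" "a < t" "t < b"
    and y: "y \<in> triod - {0}" "triod_ge (g (t *\<^sub>R u)) y"
  shows "\<exists>s\<in>{a, b}. s *\<^sub>R u \<in> P \<and> triod_ge (f (s *\<^sub>R u)) y"
proof -
  note bb = cycles_basic[OF c]
  have n: "a \<in> nodes P u" "b \<in> nodes P u" using ab by (auto simp: consecutive_def)
  have P: "a *\<^sub>R u \<in> insert 0 P" "b *\<^sub>R u \<in> insert 0 P" using nodes_basic(1) n by auto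
  have T: "a *\<^sub>R u \<in> triod" "b *\<^sub>R u \<in> triod" using P bb(2) by auto
  have "u \<noteq> 0" using u by auto
  have b1: "b \<le> 1"
    using T(2) norm_direction[OF u] nodes_basic(2)[OF n(2)] triod_iff[of "b *\<^sub>R u"] by auto
  have "t *\<^sub>R u \<in> triod"
    using ab b1 nodes_basic(2)[OF n(1)] by (intro scaleR_direction_in_triod u) auto
  then have gT: "g (t *\<^sub>R u) \<in> triod" "g (a *\<^sub>R u) \<in> triod" "g (b *\<^sub>R u) \<in> triod"
    using g T by auto
  obtain k where "\<forall>s\<in>{a..b}. \<forall>t\<in>{a..b}. arc_dist (g (s *\<^sub>R u)) (g (t *\<^sub>R u)) = k * \<bar>s - t\<bar>"
    using gaps u ab unfolding geodesic_on_gaps_def by blast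
  then have "arc_dist (g (a *\<^sub>R u)) (g (t *\<^sub>R u)) + arc_dist (g (t *\<^sub>R u)) (g (b *\<^sub>R u)) =
      arc_dist (g (a *\<^sub>R u)) (g (b *\<^sub>R u))"
    using ab by (simp add: algebra_simps)
  then have "triod_ge (g (a *\<^sub>R u)) y \<or> triod_ge (g (b *\<^sub>R u)) y"
    using geodesic_point_below_endpoint[OF gT(2,1,3)] y by blast
  then have "triod_ge (f (a *\<^sub>R u)) y \<or> triod_ge (f (b *\<^sub>R u)) y"
    unfolding g(2)[OF P(1)] g(2)[OF P(2)] .
  then obtain s where s: "s \<in> {a, b}" "triod_ge (f (s *\<^sub>R u)) y" by blast
  have "s *\<^sub>R u \<noteq> 0"
  proof
    assume "s *\<^sub>R u = 0"
    have "triod_ge 0 y" using s(2) unfolding \<open>s *\<^sub>R u = 0\<close> triod_maps_basic(2)[OF bb(1)] .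
    then show False using y(1) triod_ge_iff by simp
  qed
  moreover have "s *\<^sub>R u \<in> insert 0 P" using s(1) P by (elim insertE emptyE) simp_all
  ultimately have "s *\<^sub>R u \<in> P" by simp
  then show ?thesis using s by (intro bexI[of _ s] conjI)
qed

lemma cycle_hull:
  assumes c: "(f, P) \<in> cycles"
  shows "triod_hull P = {t *\<^sub>R p | t p. 0 \<le> t \<and> t \<le> 1 \<and> p \<in> P}"
proof -
  obtain x y where "x \<in> P" "y \<in> P" "sgn x \<noteq> sgn y" using cycle_two_branches[OF c] .
  then show ?thesis by (rule triod_hull_eq[OF cycles_basic(3,2)[OF c]])
qed

lemma cycle_hull_iff:
  assumes c: "(f, P) \<in> cycles" and z: "z \<in> triod"
  shows "z \<in> triod_hull P \<longleftrightarrow> z = 0 \<or> (\<exists>p\<in>P. triod_ge p z)"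
proof (cases "z = 0")
  case True
  obtain p where "p \<in> P" using cycles_basic(4)[OF c] by blast
  moreover have "0 = 0 *\<^sub>R p" "0 \<le> (0::real)" "(0::real) \<le> 1" by simp_all
  ultimately have "0 \<in> triod_hull P" unfolding cycle_hull[OF c] by blast
  then show ?thesis using True by simp
next
  case False
  show ?thesis
  proof
    assume "z \<in> triod_hull P"
    then obtain t p where tp: "z = t *\<^sub>R p" "0 \<le> t" "t \<le> 1" "p \<in> P"
      unfolding cycle_hull[OF c] by blast
    then have "triod_ge p z" using False cycles_basic(2)[OF c] z
      by (subst triod_ge_iff) (auto simp: sgn_scaleR mult_left_le_one_le)
    then show "z = 0 \<or> (\<exists>p\<in>P. triod_ge p z)" using tp by blast
  next
    assume "z = 0 \<or> (\<exists>p\<in>P. triod_ge p z)"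
    then obtain p where p: "p \<in> P" "sgn p = sgn z" "norm z \<le> norm p" "p \<noteq> 0"
      using False z triod_ge_iff by auto
    have "z = norm z *\<^sub>R sgn p" using p by (simp add: norm_scaleR_sgn)
    then have "z = (norm z / norm p) *\<^sub>R p" by (simp add: sgn_div_norm divide_inverse)
    moreover have "0 \<le> norm z / norm p" "norm z / norm p \<le> 1" using p by auto
    ultimately show "z \<in> triod_hull P" unfolding cycle_hull[OF c] using p by blast
  qed
qed

text \<open>Only the uniqueness of the fixed point is delicate. A fixed point \<open>z\<close> strictly between two adjacent nodes
  would give a node \<open>x \<in> P\<close> of the same gap with \<open>f x \<ge> z\<close>. As \<open>f x\<close> is a node too, it lies beyond the whole
  gap, so \<open>f x \<ge> x\<close>, contrary to \<open>no_expanded_point\<close>.\<close>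

lemma linear_map_exists:
  assumes c: "(f, P) \<in> cycles"
  shows "\<exists>g. is_linear_map f P g"
proof -
  note b = cycles_basic[OF c]
  note fT = triod_maps_basic(1)[OF b(1)]
  \<comment> \<open>On each branch separately, interpolate \<open>f\<close> between the nodes.\<close>
  define extends where "extends u G \<longleftrightarrow> continuous_on UNIV G \<and> range G \<subseteq> triod \<and>
    (\<forall>s\<in>nodes P u. G s = f (s *\<^sub>R u)) \<and>
    (\<forall>a b. consecutive (nodes P u) a b \<longrightarrow>
       (\<exists>c\<ge>0. \<forall>s\<in>{a..b}. \<forall>t\<in>{a..b}. arc_dist (G s) (G t) = c * \<bar>s - t\<bar>)) \<and>
    (\<forall>s\<in>nodes P u. (\<forall>s'\<in>nodes P u. s' \<le> s) \<longrightarrow> (\<forall>t\<ge>s. G t = f (s *\<^sub>R u)))" for u G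
  have "\<exists>G. extends u G" for u
    unfolding extends_def
  proof (rule piecewise_geodesic_exists[OF finite_nodes[OF b(3)]])
    show "(\<lambda>s. f (s *\<^sub>R u)) ` nodes P u \<subseteq> triod"
    proof
      fix w assume "w \<in> (\<lambda>s. f (s *\<^sub>R u)) ` nodes P u"
      then obtain s where s: "s \<in> nodes P u" "w = f (s *\<^sub>R u)" by blast
      then have "s *\<^sub>R u \<in> triod" using nodes_basic(1)[OF s(1)] b(2) zero_in_triod
        by (metis DiffD1 insertE subsetD)
      then show "w \<in> triod" using fT s by simp
    qed
  qed
  then obtain G where G: "\<And>u. extends u (G u)" by metis
  have Gc: "continuous_on UNIV (G u)" and GT: "G u t \<in> triod"
    and Gf: "s \<in> nodes P u \<Longrightarrow> G u s = f (s *\<^sub>R u)" for u s t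
    using G[of u] by (auto simp: extends_def)
  have Ggap: "\<exists>c\<ge>0. \<forall>s\<in>{a..b}. \<forall>t\<in>{a..b}. arc_dist (G u s) (G u t) = c * \<bar>s - t\<bar>"
    if "consecutive (nodes P u) a b" for u a b
    using G[of u] that unfolding extends_def by blast
  have Gtail: "G u t = f (s *\<^sub>R u)"
    if "s \<in> nodes P u" "\<forall>s'\<in>nodes P u. s' \<le> s" "t \<ge> s" for u s t
    using G[of u] that unfolding extends_def by blast
  have G0: "G u 0 = 0" for u
    using Gf[of 0 u] triod_maps_basic(2)[OF b(1)] by (simp add: nodes_def)
  define g where "g z = (if z = 0 then 0 else G (sgn z) (norm z))" for z
  have gu: "g (t *\<^sub>R u) = G u t" if "u ^ 3 = 1" "0 \<le> t" for u t
    using that G0 by (cases "t = 0") (auto simp: g_def sgn_scaleR_direction norm_direction)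
  have gz: "g z = G (sgn z) (norm z)" if "z \<noteq> 0" for z using that by (simp add: g_def)
  have gT: "g ` triod \<subseteq> triod" using GT by (auto simp: g_def)
  have gP: "g x = f x" if "x \<in> insert 0 P" for x
    using that Gf[OF norm_in_nodes, of x] b(2) triod_maps_basic(2)[OF b(1)]
    by (auto simp: g_def norm_scaleR_sgn)
  have gaps: "geodesic_on_gaps P g"
    unfolding geodesic_on_gaps_def
  proof (intro ballI allI impI)
    fix u s1 s2 assume u: "u \<in> directions" and con: "consecutive (nodes P u) s1 s2"
    have "0 \<le> s1" using con nodes_basic(2) by (auto simp: consecutive_def)
    then show "\<exists>c\<ge>0. \<forall>s\<in>{s1..s2}. \<forall>t\<in>{s1..s2}.
        arc_dist (g (s *\<^sub>R u)) (g (t *\<^sub>R u)) = c * \<bar>s - t\<bar>"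
      using Ggap[OF con] gu u by auto
  qed
  have cont: "continuous_on triod g"
  proof -
    have ray: "continuous_on (closed_segment 0 u) g" if u: "u \<in> directions" for u
    proof -
      have "continuous_on (closed_segment 0 u) (\<lambda>z. G u (norm z))"
        by (rule continuous_on_compose2[OF Gc]) (auto intro!: continuous_intros)
      moreover have "G u (norm z) = g z" if "z \<in> closed_segment 0 u" for z
        using that gu u by (auto simp: closed_segment_def norm_direction)
      ultimately show ?thesis by (rule continuous_on_eq)
    qed
    have "triod \<subseteq> (\<Union>u\<in>directions. closed_segment 0 u)"
    proof
      fix z assume z: "z \<in> triod"
      show "z \<in> (\<Union>u\<in>directions. closed_segment 0 u)"
      proof (cases "z = 0")
        case True
        have "(1::complex) \<in> directions" by simp
        then show ?thesis using True by (metis UN_I ends_in_segment(1))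
      next
        case False
        then have "sgn z \<in> directions" "norm z \<le> 1" using z triod_iff by auto
        moreover have "z \<in> closed_segment 0 (sgn z)"
          unfolding closed_segment_def using \<open>norm z \<le> 1\<close>
          by (auto intro!: exI[of _ "norm z"] simp: norm_scaleR_sgn)
        ultimately show ?thesis by blast
      qed
    qed
    moreover have "continuous_on (\<Union>u\<in>directions. closed_segment 0 u) g"
      by (rule continuous_on_closed_Union) (use ray in auto)
    ultimately show ?thesis using continuous_on_subset by blast
  qed
  have nofix: "z = 0" if zT: "z \<in> triod" and fix': "g z = z" for z
  proof (rule ccontr)
    assume z0: "z \<noteq> 0"
    define u where "u = sgn z"
    have u: "u ^ 3 = 1" using zT z0 triod_iff by (auto simp: u_def)
    have zu: "norm z *\<^sub>R u = z" by (simp add: u_def norm_scaleR_sgn)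
    have zge: "triod_ge z z" by (simp add: triod_ge_def)
    have nP: "z \<notin> P" 
      using gP[of z] fix' no_expanded_point[OF b(1), of z] zT z0 zge by fastforce
    have nz: "norm z \<notin> nodes P u" using nodes_basic(3)[of "norm z" P u] nP zu z0 by auto
    define m where "m = Max (nodes P u)"
    have m: "m \<in> nodes P u" "\<forall>s\<in>nodes P u. s \<le> m"
      unfolding m_def using Max_in[OF finite_nodes[OF b(3)] nodes_nonempty]
        Max_ge[OF finite_nodes[OF b(3)]] by blast+
    show False
    proof (cases "m < norm z")
      case True
      then have "g z = f (m *\<^sub>R u)" using Gtail[OF m, of "norm z"] gz[OF z0] by (simp add: u_def)
      moreover have "m *\<^sub>R u \<in> insert 0 P" using nodes_basic(1)[OF m(1)] .
      ultimately have "z \<in> insert 0 P" using fix' b(5) triod_maps_basic(2)[OF b(1)] by auto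
      then show False using z0 nP by simp
    next
      case False
      moreover have "norm z \<noteq> m" using nz m by auto
      ultimately have zm: "norm z < m" by simp
      obtain s1 s2 where s: "consecutive (nodes P u) s1 s2" "s1 < norm z" "norm z < s2"
        by (rule consecutive_exists[OF finite_nodes[OF b(3)] _ m(1) _ zm nz, of 0])
          (use z0 in \<open>auto simp: nodes_def\<close>)
      have "z \<in> triod - {0}" using zT z0 by simp
      then obtain t where t: "t \<in> {s1, s2}" "t *\<^sub>R u \<in> P" "triod_ge (f (t *\<^sub>R u)) z"
        using gap_covering[OF c gT gP gaps u s, of z] zu fix' zge by auto
      have fP: "f (t *\<^sub>R u) \<in> P" using t b(5) by auto
      have fz: "sgn (f (t *\<^sub>R u)) = u" "norm z \<le> norm (f (t *\<^sub>R u))"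
        using t(3) zT z0 triod_ge_iff by (auto simp: u_def)
      then have "norm (f (t *\<^sub>R u)) \<in> nodes P u" using norm_in_nodes[OF fP] by simp
      then have "s2 \<le> norm (f (t *\<^sub>R u))" using s fz unfolding consecutive_def
        by (metis disjoint_iff greaterThanLessThan_iff linorder_not_le order_less_le_trans)
      moreover have "0 < t" using t(1,2) b(2) s(1) nodes_basic(2)
        unfolding consecutive_def by (metis DiffE insertE insertI1 less_eq_real_def scaleR_zero_left singletonD subsetD)
      moreover have "t \<le> s2" using t s by auto
      ultimately have "triod_ge (f (t *\<^sub>R u)) (t *\<^sub>R u)"
        using t(2) fP b(2) fz(1) u by (subst triod_ge_iff) (auto simp: sgn_scaleR_direction norm_direction)
      then show False using no_expanded_point[OF b(1)] t(2) b(2) by blast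
    qed
  qed
  have maps: "g \<in> triod_maps"
  proof -
    have "g 0 = 0" by (simp add: g_def)
    then have "{x \<in> triod. g x = x} = {0}" using nofix zero_in_triod by blast
    then show ?thesis unfolding triod_maps_def using gT cont by simp
  qed
  have hullT: "triod_hull P \<subseteq> triod"
  proof
    fix z assume "z \<in> triod_hull P"
    then obtain t p where tp: "z = t *\<^sub>R p" "0 \<le> t" "t \<le> 1" "p \<in> P"
      unfolding cycle_hull[OF c] by blast
    then show "z \<in> triod" using b(2) scaleR_in_triod by blast
  qed
  have affine: "arc_affine_on J g" if J: "J \<in> components (triod_hull P - (P \<union> {0}))" for J
  proof -
    obtain z where z: "z \<in> J" using J in_components_nonempty by blast
    have Jsub: "J \<subseteq> triod_hull P - (P \<union> {0})" and Jc: "connected J"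
      using J in_components_subset in_components_connected by blast+
    define u where "u = sgn z"
    have JT: "J \<subseteq> triod - {0}" using Jsub hullT by auto
    have zT: "z \<in> triod" "z \<noteq> 0" using z JT by auto
    have sg: "sgn w = u" if "w \<in> J" for w
      using connected_imp_one_branch[OF Jc JT that z] by (simp add: u_def)
    have u: "u ^ 3 = 1" using zT triod_iff by (auto simp: u_def)
    have nn: "norm w \<notin> nodes P u" if w: "w \<in> J" for w
      using nodes_basic(3)[of "norm w" P u] sg[OF w] norm_scaleR_sgn[of w] w Jsub by auto
    obtain p where p: "p \<in> P" "triod_ge p z" using cycle_hull_iff[OF c zT(1)] z Jsub by auto
    then have pn: "norm p \<in> nodes P u" "norm z \<le> norm p"
      using norm_in_nodes[OF p(1)] triod_ge_iff[of z p] zT by (auto simp: u_def)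
    have zp: "norm z < norm p" using pn nn[OF z] by (metis order_le_less)
    obtain s1 s2 where s: "consecutive (nodes P u) s1 s2" "s1 < norm z" "norm z < s2"
      by (rule consecutive_exists[OF finite_nodes[OF b(3)] _ pn(1) _ zp nn[OF z], of 0])
        (use zT in \<open>auto simp: nodes_def\<close>)
    have s12: "s1 \<in> nodes P u" "s2 \<in> nodes P u" using s by (auto simp: consecutive_def)
    have "connected (norm ` J)" by (intro connected_continuous_image continuous_intros Jc)
    then have Icc: "{norm v..norm w} \<subseteq> norm ` J" if "v \<in> J" "w \<in> J" for v w
      using that connected_contains_Icc by blast
    have "s1 \<notin> norm ` J" "s2 \<notin> norm ` J" using nn s12 by auto
    \<comment> \<open>As \<open>J\<close> is connected and avoids the nodes, it stays within the gap of \<open>z\<close>.\<close>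
    then have rng: "s1 < norm w \<and> norm w < s2" if w: "w \<in> J" for w
      using Icc[OF w z] Icc[OF z w] s by (auto simp: subset_iff not_le[symmetric])
    obtain k where k: "k \<ge> 0"
      "\<And>s t. s \<in> {s1..s2} \<Longrightarrow> t \<in> {s1..s2} \<Longrightarrow> arc_dist (G u s) (G u t) = k * \<bar>s - t\<bar>"
      using Ggap[OF s(1)] by blast
    have "arc_dist (g v) (g w) = k * arc_dist v w" if vw: "v \<in> J" "w \<in> J" for v w
    proof -
      have "v \<in> triod" "w \<in> triod" "v \<noteq> 0" "w \<noteq> 0" using JT vw by auto
      then show ?thesis using k(2)[of "norm v" "norm w"] rng[OF vw(1)] rng[OF vw(2)] sg[OF vw(1)] sg[OF vw(2)]
        by (simp add: gz arc_dist_same_direction)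
    qed
    then show ?thesis unfolding arc_affine_on_def using k(1) by blast
  qed
  have tail: "g constant_on C" if C: "C \<in> components (triod - triod_hull P)" for C
  proof -
    obtain z where z: "z \<in> C" using C in_components_nonempty by blast
    have Csub: "C \<subseteq> triod - triod_hull P" and Cc: "connected C"
      using C in_components_subset in_components_connected by blast+
    have CT: "C \<subseteq> triod - {0}" using Csub cycle_hull_iff[OF c zero_in_triod] by blast
    define u where "u = sgn z"
    have sg: "sgn w = u" if "w \<in> C" for w
      using connected_imp_one_branch[OF Cc CT that z] by (simp add: u_def)
    define m where "m = Max (nodes P u)"
    have m: "m \<in> nodes P u" "\<forall>s\<in>nodes P u. s \<le> m"
      unfolding m_def using Max_in[OF finite_nodes[OF b(3)] nodes_nonempty]
        Max_ge[OF finite_nodes[OF b(3)]] by blast+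
    have "g w = f (m *\<^sub>R u)" if w: "w \<in> C" for w
    proof -
      have wT: "w \<in> triod" "w \<noteq> 0" "w \<notin> triod_hull P" using w CT Csub by auto
      have "s \<le> norm w" if s: "s \<in> nodes P u" for s
      proof (rule ccontr)
        assume "\<not> s \<le> norm w"
        then have "s \<noteq> 0" "norm w < s" by auto
        then obtain p where "p \<in> P" "sgn p = u" "s = norm p" using s by (auto simp: nodes_def)
        then have "triod_ge p w" using \<open>norm w < s\<close> wT sg[OF w] b(2)
          by (subst triod_ge_iff) auto
        then show False using cycle_hull_iff[OF c wT(1)] wT \<open>p \<in> P\<close> by blast
      qed
      then have "m \<le> norm w" using m by blast
      then show ?thesis using Gtail[OF m] gz[OF wT(2)] sg[OF w] by simp
    qed
    then show ?thesis by (auto simp: constant_on_def)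
  qed
  have "is_linear_map f P g"
    unfolding is_linear_map_def using maps gP affine tail by (auto simp: g_def)
  then show ?thesis by blast
qed

text \<open>Affinity is given on open gaps only; it extends to their end-points by continuity of the arc length
  metric, one argument at a time.\<close>

lemma linear_map_geodesic_on_gaps:
  assumes c: "(f, P) \<in> cycles" and lin: "is_linear_map f P g"
  shows "geodesic_on_gaps P g"
  unfolding geodesic_on_gaps_def
proof (intro ballI allI impI)
  fix u s1 s2 assume "u \<in> directions" and con: "consecutive (nodes P u) s1 s2"
  then have u: "u ^ 3 = 1" by simp
  note b = cycles_basic[OF c]
  have gm: "g \<in> triod_maps" using lin by (simp add: is_linear_map_def)
  have s: "s1 \<in> nodes P u" "s2 \<in> nodes P u" "s1 < s2" using con by (auto simp: consecutive_def)
  have s1: "0 \<le> s1" using nodes_basic(2)[OF s(1)] .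
  have s2P: "s2 *\<^sub>R u \<in> P" using nodes_basic(3)[OF s(2)] s s1 by simp
  then have s21: "s2 \<le> 1" using b(2) triod_iff[of "s2 *\<^sub>R u"] s s1 norm_direction[OF u] by auto
  have T: "t *\<^sub>R u \<in> triod" if "t \<in> {s1..s2}" for t
    using that s1 s21 by (intro scaleR_direction_in_triod u) auto
  let ?K = "(\<lambda>t. t *\<^sub>R u) ` {s1<..<s2}"
  have "connected ?K" by (intro connected_continuous_image continuous_intros) auto
  moreover have "?K \<subseteq> triod_hull P - (P \<union> {0})"
  proof
    fix z assume "z \<in> ?K"
    then obtain t where t: "z = t *\<^sub>R u" "s1 < t" "t < s2"
      by (metis (no_types) greaterThanLessThan_iff imageE)
    have sz: "sgn z = u" "norm z = t" "z \<noteq> 0"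
      using t s1 u by (auto simp: sgn_scaleR_direction norm_direction)
    have "z \<in> triod" using T t by simp
    moreover have "triod_ge (s2 *\<^sub>R u) z"
      using \<open>z \<in> triod\<close> sz t s s1 s2P b(2) u
      by (subst triod_ge_iff) (auto simp: sgn_scaleR_direction norm_direction)
    ultimately have "z \<in> triod_hull P" using cycle_hull_iff[OF c] s2P by blast
    moreover have "z \<notin> P" using norm_in_nodes[of z P] sz t con by (auto simp: consecutive_def)
    ultimately show "z \<in> triod_hull P - (P \<union> {0})" using sz by simp
  qed
  moreover have "?K \<noteq> {}" using s by simp
  ultimately obtain J where J: "J \<in> components (triod_hull P - (P \<union> {0}))" "?K \<subseteq> J"
    using exists_component_superset[of ?K "triod_hull P - (P \<union> {0})"] by blast
  obtain k where k: "k \<ge> 0" "\<forall>x\<in>J. \<forall>y\<in>J. arc_dist (g x) (g y) = k * arc_dist x y"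
    using lin J(1) unfolding is_linear_map_def arc_affine_on_def by blast
  have gT: "g (t *\<^sub>R u) \<in> triod" if "t \<in> {s1..s2}" for t
    using T[OF that] triod_maps_basic(1)[OF gm] by blast
  have inner: "arc_dist (g (s *\<^sub>R u)) (g (t *\<^sub>R u)) = k * \<bar>s - t\<bar>"
    if st: "s \<in> {s1<..<s2}" "t \<in> {s1<..<s2}" for s t
  proof -
    have "s *\<^sub>R u \<in> J" "t *\<^sub>R u \<in> J" using st J(2) by (simp_all add: image_subset_iff)
    moreover have "arc_dist (s *\<^sub>R u) (t *\<^sub>R u) = \<bar>s - t\<bar>"
      using T[of s] T[of t] st s1 u
      by (subst arc_dist_same_direction) (auto simp: sgn_scaleR_direction norm_direction)
    ultimately show ?thesis using k by simp
  qed
  have ext: "arc_dist (g (s *\<^sub>R u)) w = k * \<bar>s - t\<bar>"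
    if w: "w \<in> triod" and s: "s \<in> {s1..s2}"
      and eq: "\<And>r. r \<in> {s1<..<s2} \<Longrightarrow> arc_dist (g (r *\<^sub>R u)) w = k * \<bar>r - t\<bar>" for s t w
  proof -
    have cl: "closure {s1<..<s2} = {s1..s2}" using \<open>s1 < s2\<close> by simp
    have "continuous_on {s1..s2} (\<lambda>r. g (r *\<^sub>R u))"
      by (rule continuous_on_subset[OF continuous_on_ray[OF gm u]]) (use s1 s21 in auto)
    then have "continuous_on {s1..s2} (\<lambda>r. arc_dist (g (r *\<^sub>R u)) w - k * \<bar>r - t\<bar>)"
      by (intro continuous_intros continuous_on_arc_dist) (use gT w in auto)
    then have "arc_dist (g (s *\<^sub>R u)) w - k * \<bar>s - t\<bar> = 0"
      using continuous_constant_on_closure[of "{s1<..<s2}" "\<lambda>r. arc_dist (g (r *\<^sub>R u)) w - k * \<bar>r - t\<bar>" 0 s]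
        eq s unfolding cl by simp
    then show ?thesis by simp
  qed
  have half: "arc_dist (g (s *\<^sub>R u)) (g (t *\<^sub>R u)) = k * \<bar>s - t\<bar>"
    if st: "s \<in> {s1..s2}" "t \<in> {s1<..<s2}" for s t
    by (rule ext) (use st inner gT in auto)
  have "arc_dist (g (s *\<^sub>R u)) (g (t *\<^sub>R u)) = k * \<bar>s - t\<bar>"
    if st: "s \<in> {s1..s2}" "t \<in> {s1..s2}" for s t
  proof (rule ext)
    show "g (t *\<^sub>R u) \<in> triod" using gT st by blast
    show "s \<in> {s1..s2}" by fact
    show "arc_dist (g (r *\<^sub>R u)) (g (t *\<^sub>R u)) = k * \<bar>r - t\<bar>" if "r \<in> {s1<..<s2}" for r
      using half[OF st(2) that] by (simp add: arc_dist_commute abs_minus_commute)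
  qed
  then show "\<exists>c\<ge>0. \<forall>s\<in>{s1..s2}. \<forall>t\<in>{s1..s2}. arc_dist (g (s *\<^sub>R u)) (g (t *\<^sub>R u)) = c * \<bar>s - t\<bar>"
    using k(1) by blast
qed

text \<open>The arrows of the graph can be read off the cycle alone: in the definition of an arrow the
  intermediate point can be taken in \<open>P\<close>.\<close>

lemma arrow_iff:
  assumes c: "(f, P) \<in> cycles"
  shows "arrow f P x y \<longleftrightarrow> x \<in> P \<and> y \<in> P \<and> (\<exists>x'\<in>P. triod_ge x x' \<and> triod_ge (f x') y)"
proof -
  note b = cycles_basic[OF c]
  define g where "g = linear_map f P"
  have lin: "is_linear_map f P g"
    unfolding g_def linear_map_def using linear_map_exists[OF c] by (rule someI_ex)
  have gf: "g x = f x" if "x \<in> insert 0 P" for x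
    using lin that triod_maps_basic(2)[OF b(1)] by (auto simp: is_linear_map_def)
  have gT: "g ` triod \<subseteq> triod" using lin by (auto simp: is_linear_map_def triod_maps_def)
  show ?thesis
  proof
    assume "x \<in> P \<and> y \<in> P \<and> (\<exists>x'\<in>P. triod_ge x x' \<and> triod_ge (f x') y)"
    then show "arrow f P x y" unfolding arrow_def using gf b(2) by (auto simp flip: g_def)
  next
    assume "arrow f P x y"
    then obtain z where xy: "x \<in> P" "y \<in> P" and z: "z \<in> triod" "triod_ge x z" "triod_ge (g z) y"
      by (auto simp: arrow_def g_def)
    have z0: "z \<noteq> 0" using z xy b(2) by (auto simp: triod_ge_def triod_gt_iff)
    define u where "u = sgn z"
    have u: "u ^ 3 = 1" using z z0 triod_iff by (auto simp: u_def)
    have zu: "norm z *\<^sub>R u = z" by (simp add: u_def norm_scaleR_sgn)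
    have xz: "sgn x = u" "norm z \<le> norm x" using z z0 triod_ge_iff by (auto simp: u_def)
    have xn: "norm x \<in> nodes P u" using norm_in_nodes[OF xy(1)] xz by simp
    show "x \<in> P \<and> y \<in> P \<and> (\<exists>x'\<in>P. triod_ge x x' \<and> triod_ge (f x') y)"
    proof (cases "norm z \<in> nodes P u")
      case True
      then have "z \<in> P" using nodes_basic(3)[OF True] z0 zu by simp
      then show ?thesis using gf xy z by auto
    next
      case False
      then have lt: "norm z < norm x" using xz xn by (metis order_le_less)
      obtain s1 s2 where s: "consecutive (nodes P u) s1 s2" "s1 < norm z" "norm z < s2"
        by (rule consecutive_exists[OF finite_nodes[OF b(3)] _ xn _ lt False, of 0])
          (use z0 in \<open>auto simp: nodes_def\<close>)
      have yT: "y \<in> triod - {0}" using xy b(2) by auto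
      have "triod_ge (g (norm z *\<^sub>R u)) y" using z(3) zu by simp
      then obtain t where t: "t \<in> {s1, s2}" "t *\<^sub>R u \<in> P" "triod_ge (f (t *\<^sub>R u)) y"
        using gap_covering[OF c gT gf linear_map_geodesic_on_gaps[OF c lin] u s yT] by auto
      have "s2 \<le> norm x" using s xn lt unfolding consecutive_def
        by (metis disjoint_iff greaterThanLessThan_iff linorder_not_le order_less_trans)
      then have "t \<le> norm x" using t s by auto
      moreover have "0 \<le> t" using t s nodes_basic(2) by (auto simp: consecutive_def)
      moreover have "t \<noteq> 0" using t(2) b(2) by auto
      ultimately have "triod_ge x (t *\<^sub>R u)"
        using t(2) b(2) xy xz(1) u by (subst triod_ge_iff) (auto simp: sgn_scaleR_direction norm_direction)
      then show ?thesis using t xy by blast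
    qed
  qed
qed

section \<open>Displacements\<close>

definition branch_index :: "(complex \<Rightarrow> complex) \<Rightarrow> complex set \<Rightarrow> complex \<Rightarrow> nat" where
  "branch_index f P x = (THE i. i < 3 \<and> x \<in> canonical_ordering f P i)"

lemma branch_index_iff:
  assumes o: "is_canonical_ordering f P (canonical_ordering f P)" and x: "x \<in> triod - {0}"
  shows "i' < 3 \<and> x \<in> canonical_ordering f P i' \<longleftrightarrow> i' = branch_index f P x"
proof -
  let ?b = "canonical_ordering f P"
  have bij: "bij_betw ?b {..<3} branches" using o by (simp add: is_canonical_ordering_def)
  have "sgn x ^ 3 = 1" using x triod_iff by auto
  then have "branch (sgn x) \<in> branches" by (auto simp: branches_eq)
  then obtain i where i: "i < 3" "?b i = branch (sgn x)"
    using bij_betw_imp_surj_on[OF bij] by (metis imageE lessThan_iff)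
  have xi: "x \<in> ?b i" using i x by (simp add: branch_def)
  have uniq: "j = i" if j: "j < 3" "x \<in> ?b j" for j
  proof -
    have "?b j \<in> branches" using bij_betwE[OF bij] j by blast
    then obtain v where "?b j = branch v" by (auto simp: branches_eq)
    then have "?b j = ?b i" using j i by (auto simp: branch_def)
    then show ?thesis using inj_onD[OF bij_betw_imp_inj_on[OF bij]] i j by simp
  qed
  have eq: "branch_index f P x = i" unfolding branch_index_def
  proof (rule the_equality)
    show "i < 3 \<and> x \<in> ?b i" using i(1) xi by simp
    show "j = i" if "j < 3 \<and> x \<in> ?b j" for j using conjunct1[OF that] conjunct2[OF that] by (rule uniq)
  qed
  show ?thesis unfolding eq
  proof
    assume j: "i' < 3 \<and> x \<in> ?b i'"
    show "i' = i" using conjunct1[OF j] conjunct2[OF j] by (rule uniq)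
  qed (use i(1) xi in simp)
qed

lemma branch_index_less:
  assumes "is_canonical_ordering f P (canonical_ordering f P)" "x \<in> triod - {0}"
  shows "branch_index f P x < 3"
  using iffD2[OF branch_index_iff[OF assms] refl] by (rule conjunct1)

lemma branch_index_cong:
  assumes o: "is_canonical_ordering f P (canonical_ordering f P)"
    and x: "x \<in> triod - {0}" "y \<in> triod - {0}" "sgn x = sgn y"
  shows "branch_index f P x = branch_index f P y"
proof -
  let ?i = "branch_index f P x"
  have i: "?i < 3" "x \<in> canonical_ordering f P ?i"
    using iffD2[OF branch_index_iff[OF o x(1)] refl] by simp_all
  have "bij_betw (canonical_ordering f P) {..<3} branches"
    using o by (simp add: is_canonical_ordering_def)
  then have "canonical_ordering f P ?i \<in> branches" using i(1) bij_betwE by blast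
  then obtain v where "canonical_ordering f P ?i = branch v" by (auto simp: branches_eq)
  then have "y \<in> canonical_ordering f P ?i" using i(2) x by (auto simp: branch_def)
  then show ?thesis using iffD1[OF branch_index_iff[OF o x(2)], of ?i] i(1) by simp
qed

lemma mod3_difference_unique:
  fixes i j k :: nat
  assumes "i < 3" "j < 3" "k < 3"
  shows "(i + k) mod 3 = j \<longleftrightarrow> k = (j + 3 - i) mod 3"
proof -
  have "i \<in> {0, 1, 2}" "j \<in> {0, 1, 2}" "k \<in> {0, 1, 2}" using assms by auto
  then show ?thesis by (elim insertE emptyE) simp_all
qed

text \<open>Displacement is thus a difference of branch indices modulo \<open>3\<close>. In particular displacements along a
  walk telescope modulo \<open>1\<close>.\<close>

lemma displacement_eq:
  assumes o: "is_canonical_ordering f P (canonical_ordering f P)"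
    and x: "x \<in> triod - {0}" "y \<in> triod - {0}"
  shows "displacement f P x y = real ((branch_index f P y + 3 - branch_index f P x) mod 3) / 3"
proof -
  let ?i = "branch_index f P x" and ?j = "branch_index f P y" and ?b = "canonical_ordering f P"
  have lt: "?i < 3" "?j < 3" using branch_index_less o x by blast+
  have "(k < 3 \<and> (\<exists>i<3. x \<in> ?b i \<and> y \<in> ?b ((i + k) mod 3))) \<longleftrightarrow> k = (?j + 3 - ?i) mod 3" for k
  proof -
    have "(\<exists>i<3. x \<in> ?b i \<and> y \<in> ?b ((i + k) mod 3)) \<longleftrightarrow> y \<in> ?b ((?i + k) mod 3)"
    proof
      assume "\<exists>i<3. x \<in> ?b i \<and> y \<in> ?b ((i + k) mod 3)"
      then obtain i where i: "i < 3 \<and> x \<in> ?b i" "y \<in> ?b ((i + k) mod 3)" by blast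
      show "y \<in> ?b ((?i + k) mod 3)"
        using i(2) unfolding iffD1[OF branch_index_iff[OF o x(1)] i(1)] .
    next
      assume "y \<in> ?b ((?i + k) mod 3)"
      then show "\<exists>i<3. x \<in> ?b i \<and> y \<in> ?b ((i + k) mod 3)"
        using iffD2[OF branch_index_iff[OF o x(1)] refl] by (intro exI[of _ ?i]) simp
    qed
    also have "\<dots> \<longleftrightarrow> (?i + k) mod 3 = ?j"
      using branch_index_iff[OF o x(2), of "(?i + k) mod 3"] by auto
    finally show ?thesis using mod3_difference_unique[OF lt, of k] by auto
  qed
  then show ?thesis unfolding displacement_def by simp
qed

lemma displacement_cong:
  assumes o: "is_canonical_ordering f P (canonical_ordering f P)"
    and "x \<in> triod - {0}" "y \<in> triod - {0}" "x' \<in> triod - {0}" "y' \<in> triod - {0}"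
    and "sgn x = sgn x'" "sgn y = sgn y'"
  shows "displacement f P x y = displacement f P x' y'"
  using assms branch_index_cong[OF o, of x x'] branch_index_cong[OF o, of y y']
  by (simp add: displacement_eq)

lemma displacement_bounds:
  assumes o: "is_canonical_ordering f P (canonical_ordering f P)"
    and x: "x \<in> triod - {0}" "y \<in> triod - {0}"
  shows "0 \<le> displacement f P x y" "displacement f P x y \<le> 1"
proof -
  have "(branch_index f P y + 3 - branch_index f P x) mod 3 < 3" by simp
  then have "real ((branch_index f P y + 3 - branch_index f P x) mod 3) < 3" by linarith
  then show "0 \<le> displacement f P x y" "displacement f P x y \<le> 1"
    unfolding displacement_eq[OF assms] by auto
qed

lemma mod3_difference_add:
  fixes i j k :: nat
  assumes "i < 3" "j < 3" "k < 3"
  shows "\<exists>m. (j + 3 - i) mod 3 + (k + 3 - j) mod 3 = 3 * m + (k + 3 - i) mod 3"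
proof -
  have "((j + 3 - i) mod 3 + (k + 3 - j) mod 3) mod 3 = (k + 3 - i) mod 3"
  proof -
    have "i \<in> {0, 1, 2}" "j \<in> {0, 1, 2}" "k \<in> {0, 1, 2}" using assms by auto
    then show ?thesis by (elim insertE emptyE) simp_all
  qed
  then show ?thesis by (metis mult_div_mod_eq)
qed

text \<open>The fractional part of the total displacement \<open>t\<^sub>k\<close> of the first \<open>k\<close> steps depends only on the branch
  reached. Subtracting it from \<open>\<psi>\<close> leaves the potential
  \<open>\<Phi> (f\<^sup>k x\<^sub>0) = k * \<rho> - t\<^sub>k\<close>, which satisfies an exact recursion along the cycle and differs from \<open>\<psi>\<close> by
  a constant on each branch.\<close>

lemma code_function_potential:
  assumes c: "(f, P) \<in> cycles" and o: "is_canonical_ordering f P (canonical_ordering f P)"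
    and x0: "x\<^sub>0 \<in> P" and code: "is_code_function f P x\<^sub>0 \<psi>"
  obtains \<Phi> where "\<And>x. x \<in> P \<Longrightarrow> \<Phi> (f x) = \<Phi> x + rotation_number f P - displacement f P x (f x)"
    "\<And>x y. x \<in> P \<Longrightarrow> y \<in> P \<Longrightarrow> sgn x = sgn y \<Longrightarrow> \<Phi> x - \<Phi> y = \<psi> x - \<psi> y"
proof -
  note b = cycles_basic[OF c]
  let ?i = "branch_index f P" and ?\<rho> = "rotation_number f P"
  \<comment> \<open>Three times the fractional part of \<open>t k\<close>, at the point \<open>x = (f ^^ k) x\<^sub>0\<close>.\<close>
  define fr where "fr x = (?i x + 3 - ?i x\<^sub>0) mod 3" for x
  define \<Phi> where "\<Phi> x = \<psi> x - real (fr x) / 3" for x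
  define t where "t k = (\<Sum>j<k. displacement f P ((f ^^ j) x\<^sub>0) ((f ^^ Suc j) x\<^sub>0))" for k
  have inP: "(f ^^ k) x\<^sub>0 \<in> P" for k using cycle_iterate_in[OF c x0] .
  have inT: "(f ^^ k) x\<^sub>0 \<in> triod - {0}" for k using inP b(2) by blast
  have lt: "?i ((f ^^ k) x\<^sub>0) < 3" for k using branch_index_less[OF o inT] .
  have lt0: "?i x\<^sub>0 < 3" using lt[of 0] by simp
  have tk: "\<exists>m::int. t k = of_int m + real (fr ((f ^^ k) x\<^sub>0)) / 3" for k
  proof (induction k)
    case 0
    then show ?case using lt0 by (auto simp: t_def fr_def intro!: exI[of _ 0])
  next
    case (Suc k)
    then obtain m :: int where m: "t k = of_int m + real (fr ((f ^^ k) x\<^sub>0)) / 3" by blast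
    obtain m' where m': "fr ((f ^^ k) x\<^sub>0) + (?i ((f ^^ Suc k) x\<^sub>0) + 3 - ?i ((f ^^ k) x\<^sub>0)) mod 3
        = 3 * m' + fr ((f ^^ Suc k) x\<^sub>0)"
      unfolding fr_def using mod3_difference_add[OF lt0 lt lt] by blast
    have "t (Suc k) = t k + displacement f P ((f ^^ k) x\<^sub>0) ((f ^^ Suc k) x\<^sub>0)"
      by (simp add: t_def)
    also have "displacement f P ((f ^^ k) x\<^sub>0) ((f ^^ Suc k) x\<^sub>0) =
        real ((?i ((f ^^ Suc k) x\<^sub>0) + 3 - ?i ((f ^^ k) x\<^sub>0)) mod 3) / 3"
      by (rule displacement_eq[OF o inT inT])
    also have "t k + \<dots> = of_int m + real (fr ((f ^^ k) x\<^sub>0) +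
        (?i ((f ^^ Suc k) x\<^sub>0) + 3 - ?i ((f ^^ k) x\<^sub>0)) mod 3) / 3"
      unfolding m of_nat_add by (simp add: add_divide_distrib)
    also have "\<dots> = of_int (m + int m') + real (fr ((f ^^ Suc k) x\<^sub>0)) / 3"
      unfolding m' of_nat_add by (simp add: add_divide_distrib)
    finally show ?case by blast
  qed
  have \<Phi>k: "\<Phi> ((f ^^ k) x\<^sub>0) = real k * ?\<rho> - t k" for k
  proof -
    obtain m :: int where m: "t k = of_int m + real (fr ((f ^^ k) x\<^sub>0)) / 3" using tk by blast
    have "fr ((f ^^ k) x\<^sub>0) < 3" by (simp add: fr_def)
    then have "\<lfloor>t k\<rfloor> = m" unfolding m by (intro floor_unique) auto
    moreover have "\<psi> ((f ^^ k) x\<^sub>0) = real k * ?\<rho> - of_int \<lfloor>t k\<rfloor>"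
      using code unfolding is_code_function_def t_def by blast
    ultimately show ?thesis using m by (simp add: \<Phi>_def)
  qed
  show ?thesis
  proof (rule that[of \<Phi>])
    fix x assume "x \<in> P"
    then obtain k where k: "x = (f ^^ k) x\<^sub>0" using b(8)[OF x0] by blast
    have "f x = (f ^^ Suc k) x\<^sub>0" by (simp add: k)
    then show "\<Phi> (f x) = \<Phi> x + ?\<rho> - displacement f P x (f x)"
      using \<Phi>k[of k] \<Phi>k[of "Suc k"] by (simp add: k t_def algebra_simps)
  next
    fix x y assume "x \<in> P" "y \<in> P" "sgn x = sgn y"
    then have "?i x = ?i y" using branch_index_cong[OF o] b(2) by blast
    then show "\<Phi> x - \<Phi> y = \<psi> x - \<psi> y" by (simp add: \<Phi>_def fr_def)
  qed
qed

section \<open>Loops\<close>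

lemma sum_cyclic_shift:
  fixes g :: "'a \<Rightarrow> 'b::comm_monoid_add"
  assumes "vs \<noteq> []"
  shows "(\<Sum>i<length vs. g (vs ! (Suc i mod length vs))) = (\<Sum>i<length vs. g (vs ! i))"
proof -
  obtain m where m: "length vs = Suc m" using assms by (cases vs) auto
  have "(\<Sum>i<m. g (vs ! (Suc i mod Suc m))) = (\<Sum>i<m. g (vs ! Suc i))"
    by (intro sum.cong) auto
  then have "(\<Sum>i<Suc m. g (vs ! (Suc i mod Suc m))) = g (vs ! 0) + (\<Sum>i<m. g (vs ! Suc i))"
    by (simp add: add.commute)
  also have "\<dots> = (\<Sum>i<Suc m. g (vs ! i))" by (rule sum.lessThan_Suc_shift [symmetric])
  finally show ?thesis by (simp only: m)
qed

text \<open>The heart of the matter. For an arrow \<open>x \<rightarrow> y\<close> choose \<open>x' \<in> P\<close> with \<open>x \<ge> x'\<close> and \<open>f x' \<ge> y\<close>. The arrows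
  \<open>x \<rightarrow> y\<close> and \<open>x' \<rightarrow> f x'\<close> join the same branches and have the same displacement \<open>d\<close>. If \<open>\<Phi>\<close> does not
  increase outwards, then \<open>\<Phi> y \<ge> \<Phi> (f x') = \<Phi> x' + \<rho> - d \<ge> \<Phi> x + \<rho> - d\<close>, and summing over a loop cancels
  the potential. The sign \<open>\<sigma>\<close> covers the reversed monotonicity too.\<close>

lemma loop_displacement_bound:
  assumes c: "(f, P) \<in> cycles" and o: "is_canonical_ordering f P (canonical_ordering f P)"
    and step: "\<And>x. x \<in> P \<Longrightarrow> \<Phi> (f x) = \<Phi> x + \<rho> - displacement f P x (f x)"
    and mono: "\<And>x y. x \<in> P \<Longrightarrow> y \<in> P \<Longrightarrow> triod_gt x y \<Longrightarrow> \<sigma> * \<Phi> x \<le> \<sigma> * \<Phi> y"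
    and vs: "vs \<in> loops f P"
  shows "\<sigma> * (real (length vs) * \<rho>) \<le> \<sigma> * loop_displacement f P vs"
proof -
  note b = cycles_basic[OF c]
  have ge: "\<sigma> * \<Phi> x \<le> \<sigma> * \<Phi> y" if "x \<in> P" "y \<in> P" "triod_ge x y" for x y
    using that mono by (auto simp: triod_ge_def)
  have arr: "\<sigma> * \<Phi> x + \<sigma> * \<rho> - \<sigma> * displacement f P x y \<le> \<sigma> * \<Phi> y" if a: "arrow f P x y" for x y
  proof -
    obtain x' where x': "x \<in> P" "y \<in> P" "x' \<in> P" "triod_ge x x'" "triod_ge (f x') y"
      using a arrow_iff[OF c] by blast
    have fx': "f x' \<in> P" using x' b(5) by blast
    have T: "x \<in> triod - {0}" "y \<in> triod - {0}" "x' \<in> triod - {0}" "f x' \<in> triod - {0}"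
      using x' fx' b(2) by blast+
    have "displacement f P x y = displacement f P x' (f x')"
      using triod_ge_iff[OF T(3)] triod_ge_iff[OF T(2)] x' by (intro displacement_cong o T) auto
    then have "\<sigma> * \<Phi> (f x') = \<sigma> * \<Phi> x' + \<sigma> * \<rho> - \<sigma> * displacement f P x y"
      unfolding step[OF x'(3)] by (simp add: algebra_simps)
    then show ?thesis using ge[OF x'(1,3,4)] ge[OF fx' x'(2,5)] by linarith
  qed
  let ?n = "length vs"
  have ne: "vs \<noteq> []" and a: "\<And>i. i < ?n \<Longrightarrow> arrow f P (vs ! i) (vs ! (Suc i mod ?n))"
    using vs by (auto simp: loops_def)
  have "(\<Sum>i<?n. \<sigma> * \<Phi> (vs ! i) + \<sigma> * \<rho> - \<sigma> * displacement f P (vs ! i) (vs ! (Suc i mod ?n)))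
      \<le> (\<Sum>i<?n. \<sigma> * \<Phi> (vs ! (Suc i mod ?n)))"
    by (intro sum_mono arr a) simp
  also have "\<dots> = (\<Sum>i<?n. \<sigma> * \<Phi> (vs ! i))" by (rule sum_cyclic_shift[OF ne])
  finally have "(\<Sum>i<?n. \<sigma> * \<rho>) \<le> \<sigma> * loop_displacement f P vs"
    by (simp add: sum.distrib sum_subtractf loop_displacement_def sum_distrib_left)
  then show ?thesis by (simp add: algebra_simps)
qed

text \<open>Writing the rotation number as a mean over \<open>P\<close> frees it from the starting point of the loop.\<close>

lemma cycle_loop_in_loops:
  assumes c: "(f, P) \<in> cycles"
  shows "cycle_loop f P \<in> loops f P"
    and "rotation_number f P = (\<Sum>x\<in>P. displacement f P x (f x)) / real (card P)"
proof -
  note b = cycles_basic[OF c]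
  define x where "x = (SOME x. x \<in> P)"
  have x: "x \<in> P" unfolding x_def using b(4) by (simp add: some_in_eq)
  have n: "card P > 0" using b(3,4) by (simp add: card_gt_0_iff)
  let ?vs = "map (\<lambda>k. (f ^^ k) x) [0..<card P]"
  have vs: "cycle_loop f P = ?vs" by (simp add: cycle_loop_def x_def Let_def)
  have nxt: "?vs ! (Suc i mod card P) = f (?vs ! i)" if "i < card P" for i
    using that n funpow_mod_eq[OF b(7)[OF x], of "Suc i"] by simp
  have inP: "(f ^^ i) x \<in> P" for i using cycle_iterate_in[OF c x] .
  have "arrow f P y (f y)" if "y \<in> P" for y
    using that b(5) unfolding arrow_iff[OF c] by (auto simp: triod_ge_def)
  then show "cycle_loop f P \<in> loops f P"
    unfolding vs loops_def using nxt inP n by auto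
  have "loop_displacement f P ?vs = (\<Sum>i<card P. displacement f P ((f ^^ i) x) (f ((f ^^ i) x)))"
    unfolding loop_displacement_def using nxt by (intro sum.cong) auto
  also have "\<dots> = (\<Sum>x\<in>P. displacement f P x (f x))"
    by (rule sum.reindex_bij_betw[OF b(6)[OF x]])
  finally show "rotation_number f P = (\<Sum>x\<in>P. displacement f P x (f x)) / real (card P)"
    by (simp add: rotation_number_def loop_rotation_number_def vs)
qed

section \<open>The rotation interval\<close>

inductive walk :: "(complex \<Rightarrow> complex) \<Rightarrow> complex set \<Rightarrow> complex \<Rightarrow> nat \<Rightarrow> real \<Rightarrow> complex \<Rightarrow> bool"
  for f P where
  walk_refl: "walk f P x 0 0 x"
| walk_step: "arrow f P x y \<Longrightarrow> walk f P y n D z \<Longrightarrow> walk f P x (Suc n) (displacement f P x y + D) z"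

lemma walk_trans: "walk f P x n D y \<Longrightarrow> walk f P y n' D' z \<Longrightarrow> walk f P x (n + n') (D + D') z"
proof (induction rule: walk.induct)
  case (walk_step x y n D y')
  then have "walk f P x (Suc (n + n')) (displacement f P x y + (D + D')) z"
    by (intro walk.walk_step) auto
  then show ?case by (simp add: add.assoc)
qed simp

lemma walk_repeat: "walk f P x n D x \<Longrightarrow> walk f P x (q * n) (real q * D) x"
proof (induction q)
  case 0
  then show ?case by (simp add: walk_refl)
next
  case (Suc q)
  then show ?case using walk_trans[of f P x n D x "q * n" "real q * D" x] by (simp add: algebra_simps)
qed

lemma loop_imp_walk:
  assumes vs: "vs \<in> loops f P"
  shows "walk f P (vs ! 0) (length vs) (loop_displacement f P vs) (vs ! 0)"
proof -
  let ?n = "length vs"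
  have ne: "?n > 0" and a: "\<And>i. i < ?n \<Longrightarrow> arrow f P (vs ! i) (vs ! (Suc i mod ?n))"
    using vs by (auto simp: loops_def)
  have "walk f P (vs ! 0) k (\<Sum>i<k. displacement f P (vs ! i) (vs ! (Suc i mod ?n))) (vs ! (k mod ?n))"
    if "k \<le> ?n" for k
    using that
  proof (induction k)
    case 0
    then show ?case using ne by (simp add: walk_refl)
  next
    case (Suc k)
    then have k: "k < ?n" "k mod ?n = k" by auto
    have "walk f P (vs ! k) (Suc 0) (displacement f P (vs ! k) (vs ! (Suc k mod ?n)) + 0) (vs ! (Suc k mod ?n))"
      using a[OF k(1)] by (intro walk_step walk_refl)
    then show ?case using walk_trans[OF Suc.IH] Suc.prems k by fastforce
  qed
  from this[of ?n] show ?thesis using ne by (simp add: loop_displacement_def)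
qed

lemma walk_imp_function:
  "walk f P x n D y \<Longrightarrow> \<exists>p. p 0 = x \<and> p n = y \<and> (\<forall>i<n. arrow f P (p i) (p (Suc i))) \<and>
     D = (\<Sum>i<n. displacement f P (p i) (p (Suc i)))"
proof (induction rule: walk.induct)
  case (walk_refl x)
  show ?case by (intro exI[of _ "\<lambda>_. x"]) simp
next
  case (walk_step x y n D z)
  then obtain p where p: "p 0 = y" "p n = z" "\<forall>i<n. arrow f P (p i) (p (Suc i))"
    "D = (\<Sum>i<n. displacement f P (p i) (p (Suc i)))" by blast
  have "\<forall>i<Suc n. arrow f P (case_nat x p i) (p i)"
    using p walk_step.hyps(1) by (auto split: nat.split)
  moreover have "displacement f P x y + D =
      (\<Sum>i<Suc n. displacement f P (case_nat x p i) (case_nat x p (Suc i)))"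
    unfolding sum.lessThan_Suc_shift using p by simp
  ultimately show ?case using p by (intro exI[of _ "case_nat x p"]) simp
qed

lemma closed_walk_imp_loop:
  assumes w: "walk f P x n D x" and n: "n > 0"
  shows "D / real n \<in> loop_rotation_number f P ` loops f P"
proof -
  obtain p where p: "p 0 = x" "p n = x" "\<And>i. i < n \<Longrightarrow> arrow f P (p i) (p (Suc i))"
    "D = (\<Sum>i<n. displacement f P (p i) (p (Suc i)))" using walk_imp_function[OF w] by blast
  let ?vs = "map p [0..<n]"
  have nxt: "?vs ! (Suc i mod n) = p (Suc i)" if "i < n" for i
    using that p(1,2) n by (cases "Suc i = n") auto
  then have "?vs \<in> loops f P" using p(3) n by (auto simp: loops_def)
  moreover have "loop_rotation_number f P ?vs = D / real n"
    unfolding loop_rotation_number_def loop_displacement_def p(4) using nxt by simp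
  ultimately show ?thesis by (metis imageI)
qed

text \<open>Following the cycle itself leads from each of its points to every other one.\<close>

lemma walk_connected:
  assumes c: "(f, P) \<in> cycles" and xy: "x \<in> P" "y \<in> P"
  obtains n D where "walk f P x n D y"
proof -
  note b = cycles_basic[OF c]
  have "\<exists>n D. walk f P x n D ((f ^^ k) x)" for k
  proof (induction k)
    case 0
    show ?case using walk_refl[of f P x] by (intro exI) simp
  next
    case (Suc k)
    let ?z = "(f ^^ k) x"
    have z: "?z \<in> P" using cycle_iterate_in[OF c xy(1)] .
    then have "arrow f P ?z (f ?z)"
      using b(5) unfolding arrow_iff[OF c] by (auto simp: triod_ge_def)
    then have "walk f P ?z (Suc 0) (displacement f P ?z (f ?z) + 0) (f ?z)"
      by (intro walk_step walk_refl)
    then show ?case using Suc walk_trans by fastforce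
  qed
  moreover obtain k where "y = (f ^^ k) x" using b(8)[OF xy] by blast
  ultimately show ?thesis using that by blast
qed

lemma tendsto_linear_quotient:
  fixes \<alpha> \<beta> \<gamma> \<delta> :: real
  assumes "\<gamma> > 0"
  shows "(\<lambda>q. (real q * \<alpha> + \<beta>) / (real q * \<gamma> + \<delta>)) \<longlonglongrightarrow> \<alpha> / \<gamma>"
proof -
  have "(\<lambda>q. (\<alpha> + \<beta> / real q) / (\<gamma> + \<delta> / real q)) \<longlonglongrightarrow> (\<alpha> + 0) / (\<gamma> + 0)"
    by (intro tendsto_intros lim_const_over_n) (use assms in auto)
  moreover have "\<forall>\<^sub>F q in sequentially.
      (\<alpha> + \<beta> / real q) / (\<gamma> + \<delta> / real q) = (real q * \<alpha> + \<beta>) / (real q * \<gamma> + \<delta>)"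
    using eventually_gt_at_top[of 0]
  proof eventually_elim
    case (elim q)
    have "(real q * \<alpha> + \<beta>) / (real q * \<gamma> + \<delta>) =
        (real q * (\<alpha> + \<beta> / real q)) / (real q * (\<gamma> + \<delta> / real q))"
      using elim by (simp add: distrib_left)
    then show ?case using elim by simp
  qed
  ultimately show ?thesis using Lim_transform_eventually by fastforce
qed

text \<open>Run through the two loops very often, in such proportions that both take up the same time, and join
  them by two fixed walks, whose contribution vanishes in the limit.\<close>

lemma midpoint_of_loops:
  assumes c: "(f, P) \<in> cycles"
    and r: "r \<in> loop_rotation_number f P ` loops f P" "s \<in> loop_rotation_number f P ` loops f P"
  shows "(r + s) / 2 \<in> closure (loop_rotation_number f P ` loops f P)"
proof -
  let ?X = "loop_rotation_number f P ` loops f P"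
  have get: "\<exists>x n D. x \<in> P \<and> n > 0 \<and> walk f P x n D x \<and> r = D / real n" if rX: "r \<in> ?X" for r
  proof -
    obtain vs where vs: "vs \<in> loops f P" "r = loop_rotation_number f P vs"
      using rX by (elim imageE)
    then have "vs \<noteq> []" "vs ! 0 \<in> P" by (auto simp: loops_def arrow_def)
    then show ?thesis using loop_imp_walk[OF vs(1)] vs(2) unfolding loop_rotation_number_def by blast
  qed
  obtain x n D where x: "x \<in> P" "n > 0" "walk f P x n D x" "r = D / real n" using get[OF r(1)] by blast
  obtain y m E where y: "y \<in> P" "m > 0" "walk f P y m E y" "s = E / real m" using get[OF r(2)] by blast
  obtain a A where a: "walk f P x a A y" using walk_connected[OF c x(1) y(1)] .
  obtain e B where e: "walk f P y e B x" using walk_connected[OF c y(1) x(1)] .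
  \<comment> \<open>Running \<open>m\<close> times through the loop of length \<open>n\<close> takes as long as \<open>n\<close> times through that of length \<open>m\<close>.\<close>
  define \<alpha> where "\<alpha> = real m * D + real n * E"
  define \<gamma> where "\<gamma> = 2 * real n * real m"
  have "(real q * \<alpha> + (A + B)) / (real q * \<gamma> + real (a + e)) \<in> ?X" if "q > 0" for q
  proof -
    have "walk f P x ((q * m * n + a) + (q * n * m + e)) ((real (q * m) * D + A) + (real (q * n) * E + B)) x"
      by (intro walk_trans[of f P x _ _ y] walk_trans[of f P x _ _ x] walk_trans[of f P y _ _ y]
          walk_repeat x(3) y(3) a e)
    moreover have "real (q * m) * D + A + (real (q * n) * E + B) = real q * \<alpha> + (A + B)"
      by (simp add: \<alpha>_def algebra_simps)
    moreover have "real (q * m * n + a + (q * n * m + e)) = real q * \<gamma> + real (a + e)"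
      by (simp add: \<gamma>_def algebra_simps)
    moreover have "q * m * n + a + (q * n * m + e) > 0" using that x(2) y(2) by simp
    ultimately show ?thesis using closed_walk_imp_loop by metis
  qed
  then have "\<forall>q. (real (Suc q) * \<alpha> + (A + B)) / (real (Suc q) * \<gamma> + real (a + e)) \<in> ?X" by blast
  moreover have "(\<lambda>q. (real (Suc q) * \<alpha> + (A + B)) / (real (Suc q) * \<gamma> + real (a + e))) \<longlonglongrightarrow> \<alpha> / \<gamma>"
    by (rule LIMSEQ_Suc[OF tendsto_linear_quotient]) (use x y in \<open>simp add: \<gamma>_def\<close>)
  ultimately have "\<alpha> / \<gamma> \<in> closure ?X"
    unfolding closure_sequential by (intro exI[of _ "\<lambda>q. (real (Suc q) * \<alpha> + (A + B)) / (real (Suc q) * \<gamma> + real (a + e))"]) auto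
  moreover have "\<alpha> / \<gamma> = (r + s) / 2"
    using x(2) y(2) by (simp add: \<alpha>_def \<gamma>_def x(4) y(4) field_simps)
  ultimately show ?thesis by simp
qed

lemma midpoint_closure:
  fixes X :: "real set"
  assumes "\<And>r s. r \<in> X \<Longrightarrow> s \<in> X \<Longrightarrow> (r + s) / 2 \<in> closure X"
    and "r \<in> closure X" "s \<in> closure X"
  shows "(r + s) / 2 \<in> closure X"
proof -
  obtain a b where a: "\<And>n. a n \<in> X" "a \<longlonglongrightarrow> r" and b: "\<And>n. b n \<in> X" "b \<longlonglongrightarrow> s"
    using assms(2,3) unfolding closure_sequential by blast
  have "(\<lambda>n. (a n + b n) / 2) \<longlonglongrightarrow> (r + s) / 2" by (intro tendsto_intros a b) auto
  then show ?thesis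
    using closed_sequentially[OF closed_closure[of X], of "\<lambda>n. (a n + b n) / 2"] assms(1) a b by blast
qed

text \<open>A gap \<open>(a, b)\<close> of a closed set would contain the midpoint of its two end-points.\<close>

lemma closed_midpoint_convex_interval:
  fixes C :: "real set"
  assumes C: "closed C" "bounded C" "C \<noteq> {}"
    and mid: "\<And>r s. r \<in> C \<Longrightarrow> s \<in> C \<Longrightarrow> (r + s) / 2 \<in> C"
  shows "C = {Inf C..Sup C}"
proof
  have bdd: "bdd_above C" "bdd_below C" using C bounded_imp_bdd_above bounded_imp_bdd_below by auto
  show "C \<subseteq> {Inf C..Sup C}" using bdd cInf_lower cSup_upper by auto
  show "{Inf C..Sup C} \<subseteq> C"
  proof
    fix t assume t: "t \<in> {Inf C..Sup C}"
    have ends: "Inf C \<in> C" "Sup C \<in> C"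
      using closed_contains_Inf[OF C(3) bdd(2) C(1)] closed_contains_Sup[OF C(3) bdd(1) C(1)] by auto
    define A where "A = C \<inter> {..t}"
    define B where "B = C \<inter> {t..}"
    have A: "closed A" "A \<noteq> {}" "bdd_above A" and B: "closed B" "B \<noteq> {}" "bdd_below B"
      using C(1) ends t by (auto simp: A_def B_def)
    define a where "a = Sup A"
    define b where "b = Inf B"
    have a: "a \<in> A" and b: "b \<in> B"
      unfolding a_def b_def
      using closed_contains_Sup[OF A(2,3,1)] closed_contains_Inf[OF B(2,3,1)] by auto
    have le: "\<And>x. x \<in> A \<Longrightarrow> x \<le> a" and ge: "\<And>x. x \<in> B \<Longrightarrow> b \<le> x"
      unfolding a_def b_def using A B cSup_upper cInf_lower by auto
    have "(a + b) / 2 \<in> C" using a b mid by (simp add: A_def B_def)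
    then have "(a + b) / 2 \<in> A \<or> (a + b) / 2 \<in> B" by (auto simp: A_def B_def)
    then have "b \<le> a" using le ge by fastforce
    then have "t = a" using a b by (auto simp: A_def B_def)
    then show "t \<in> C" using a by (simp add: A_def)
  qed
qed

lemma rotation_interval_is_interval:
  assumes c: "(f, P) \<in> cycles" and o: "is_canonical_ordering f P (canonical_ordering f P)"
  obtains l u where "l \<le> u" "rotation_interval f P = {l..u}"
    "rotation_number f P \<in> rotation_interval f P"
proof -
  note b = cycles_basic[OF c]
  let ?X = "loop_rotation_number f P ` loops f P"
  have "?X \<subseteq> {0..1}"
  proof clarify
    fix vs assume vs: "vs \<in> loops f P"
    let ?n = "length vs"
    have ne: "?n > 0" and a: "\<And>i. i < ?n \<Longrightarrow> arrow f P (vs ! i) (vs ! (Suc i mod ?n))"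
      using vs by (auto simp: loops_def)
    have d: "0 \<le> displacement f P (vs ! i) (vs ! (Suc i mod ?n)) \<and>
        displacement f P (vs ! i) (vs ! (Suc i mod ?n)) \<le> 1" if "i < ?n" for i
      using displacement_bounds[OF o] a[OF that] b(2) unfolding arrow_def by blast
    have "0 \<le> loop_displacement f P vs" unfolding loop_displacement_def
      using d by (intro sum_nonneg) auto
    moreover have "loop_displacement f P vs \<le> (\<Sum>i<?n. 1)" unfolding loop_displacement_def
      using d by (intro sum_mono) auto
    ultimately show "loop_rotation_number f P vs \<in> {0..1}"
      using ne by (simp add: loop_rotation_number_def field_simps)
  qed
  then have "bounded (closure ?X)" using bounded_closure bounded_subset bounded_closed_interval by metis
  moreover have \<rho>: "rotation_number f P \<in> closure ?X"
    using cycle_loop_in_loops(1)[OF c] closure_subset[of ?X] unfolding rotation_number_def by blast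
  moreover have "closure ?X \<noteq> {}" using \<rho> by (metis empty_iff)
  moreover have "(r + s) / 2 \<in> closure ?X" if "r \<in> closure ?X" "s \<in> closure ?X" for r s
    by (rule midpoint_closure[OF midpoint_of_loops[OF c] that])
  ultimately have I: "closure ?X = {Inf (closure ?X)..Sup (closure ?X)}"
    by (intro closed_midpoint_convex_interval closed_closure)
  define l where "l = Inf (closure ?X)"
  define u where "u = Sup (closure ?X)"
  have lu: "closure ?X = {l..u}" unfolding l_def u_def by (rule I)
  have "l \<le> u" using \<rho> unfolding lu by simp
  then show ?thesis using that[of l u] \<rho> lu unfolding rotation_interval_def by simp
qed

section \<open>Frontier patterns\<close>

theorem theorem3p7:
  fixes \<pi> :: pattern
  assumes "regular_pattern \<pi>"
    and "pattern_rotation_number \<pi> \<noteq> 1/3"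
    and "nondecreasing_code_pattern \<pi>"
  shows "frontier_pattern \<pi>"
proof -
  have pat: "\<pi> \<in> patterns" using assms(1) by (simp add: regular_pattern_def)
  obtain f P where fP: "(f, P) \<in> \<pi>" and nd: "nondecreasing_code f P"
    using assms(3) by (auto simp: nondecreasing_code_pattern_def)
  \<comment> \<open>The cycle by which the invariants of \<open>\<pi>\<close> are computed may differ from the one whose code is
      non-decreasing, so the potential is pulled back along an isomorphism \<open>k\<close>.\<close>
  obtain g Q where gQ: "(SOME c. c \<in> \<pi>) = (g, Q)" by (metis surj_pair)
  then have gQin: "(g, Q) \<in> \<pi>" using fP by (metis someI_ex)
  obtain k where cQ: "(g, Q) \<in> cycles" and cP: "(f, P) \<in> cycles" and iso: "cycle_iso g Q f P k"
    using pattern_members[OF pat gQin fP] by auto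
  have oQ: "is_canonical_ordering g Q (canonical_ordering g Q)"
    and oP: "is_canonical_ordering f P (canonical_ordering f P)"
    using canonical_ordering_exists[OF assms(1)] gQin fP by blast+
  note bQ = cycles_basic[OF cQ] and bP = cycles_basic[OF cP]
  have dd: "displacement f P = displacement g Q" using cycle_iso_displacement_eq[OF iso cQ cP] .
  have k: "bij_betw k Q P" "\<And>y. y \<in> Q \<Longrightarrow> k y \<in> P" "\<And>y. y \<in> Q \<Longrightarrow> sgn (k y) = sgn y"
    "\<And>y. y \<in> Q \<Longrightarrow> k (g y) = f (k y)"
    using iso by (auto simp: cycle_iso_def bij_betw_def)
  have gin: "g y \<in> Q" if "y \<in> Q" for y using that bQ(5) by blast
  have dk: "displacement f P (k y) (f (k y)) = displacement g Q y (g y)" if y: "y \<in> Q" for y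
  proof -
    have "displacement g Q (k y) (k (g y)) = displacement g Q y (g y)"
      using k(2,3)[OF y] k(2,3)[OF gin[OF y]] bP(2) bQ(2) y gin[OF y]
      by (intro displacement_cong[OF oQ]) auto
    then show ?thesis using dd k(4)[OF y] by simp
  qed
  let ?\<rho> = "rotation_number g Q"
  have "(\<Sum>y\<in>Q. displacement g Q y (g y)) = (\<Sum>y\<in>Q. displacement f P (k y) (f (k y)))"
    by (intro sum.cong) (auto simp: dk)
  also have "\<dots> = (\<Sum>x\<in>P. displacement f P x (f x))"
    by (rule sum.reindex_bij_betw[OF k(1)])
  finally have \<rho>: "rotation_number f P = ?\<rho>"
    using cycle_loop_in_loops(2)[OF cP] cycle_loop_in_loops(2)[OF cQ] bij_betw_same_card[OF k(1)] by simp
  obtain x0 \<psi> where x0: "x0 \<in> P" and code: "is_code_function f P x0 \<psi>"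
    and lt: "?\<rho> < 1/3 \<Longrightarrow> \<forall>x\<in>P. \<forall>y\<in>P. triod_gt x y \<longrightarrow> \<psi> x \<le> \<psi> y"
    and gt: "?\<rho> > 1/3 \<Longrightarrow> \<forall>x\<in>P. \<forall>y\<in>P. triod_gt x y \<longrightarrow> \<psi> x \<ge> \<psi> y"
    using nd \<rho> unfolding nondecreasing_code_def by auto
  obtain \<Phi> where \<Phi>: "\<And>x. x \<in> P \<Longrightarrow> \<Phi> (f x) = \<Phi> x + ?\<rho> - displacement f P x (f x)"
    "\<And>x y. x \<in> P \<Longrightarrow> y \<in> P \<Longrightarrow> sgn x = sgn y \<Longrightarrow> \<Phi> x - \<Phi> y = \<psi> x - \<psi> y"
    using code_function_potential[OF cP oP x0 code] \<rho> by metis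
  have step: "\<Phi> (k (g y)) = \<Phi> (k y) + ?\<rho> - displacement g Q y (g y)" if "y \<in> Q" for y
    using \<Phi>(1)[OF k(2)[OF that]] dk[OF that] k(4)[OF that] by simp
  have gtk: "triod_gt (k x) (k y) \<and> \<Phi> (k x) - \<Phi> (k y) = \<psi> (k x) - \<psi> (k y)"
    if xy: "x \<in> Q" "y \<in> Q" "triod_gt x y" for x y
  proof -
    have s: "sgn x = sgn y" "norm y < norm x" using xy by (auto simp: triod_gt_iff)
    then have "norm (k y) < norm (k x)" using iso xy unfolding cycle_iso_def by auto
    moreover have "k x \<in> triod - {0}" "k y \<in> triod - {0}" using k(2) xy bP(2) by blast+
    ultimately show ?thesis using s k(2,3) xy \<Phi>(2) by (auto simp: triod_gt_iff)
  qed
  obtain l u where lu: "l \<le> u" "rotation_interval g Q = {l..u}" "?\<rho> \<in> rotation_interval g Q"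
    using rotation_interval_is_interval[OF cQ oQ] .
  have pr: "pattern_rotation_number \<pi> = ?\<rho>" "pattern_rotation_interval \<pi> = rotation_interval g Q"
    by (simp_all add: pattern_rotation_number_def pattern_rotation_interval_def gQ)
  have bound: "{l..u} \<subseteq> {r. \<sigma> * ?\<rho> \<le> \<sigma> * r}"
    if mono: "\<And>x y. x \<in> Q \<Longrightarrow> y \<in> Q \<Longrightarrow> triod_gt x y \<Longrightarrow> \<sigma> * \<Phi> (k x) \<le> \<sigma> * \<Phi> (k y)" for \<sigma> :: real
  proof -
    have "loop_rotation_number g Q ` loops g Q \<subseteq> {r. \<sigma> * ?\<rho> \<le> \<sigma> * r}"
    proof clarify
      fix vs assume vs: "vs \<in> loops g Q"
      then have n: "real (length vs) > 0" by (auto simp: loops_def)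
      have "\<sigma> * (real (length vs) * ?\<rho>) \<le> \<sigma> * loop_displacement g Q vs"
        by (rule loop_displacement_bound[OF cQ oQ step mono vs])
      then show "\<sigma> * ?\<rho> \<le> \<sigma> * loop_rotation_number g Q vs"
        using n by (simp add: loop_rotation_number_def pos_le_divide_eq mult_ac)
    qed
    moreover have "closed {r. \<sigma> * ?\<rho> \<le> \<sigma> * r}"
      by (intro closed_Collect_le continuous_intros)
    ultimately show ?thesis
      using lu(2) closure_minimal unfolding rotation_interval_def by metis
  qed
  have "?\<rho> \<in> {l, u}"
  proof (cases "?\<rho> < 1/3")
    case True
    \<comment> \<open>The potential does not increase outwards, so no loop rotates slower than the cycle.\<close>
    have "{l..u} \<subseteq> {r. 1 * ?\<rho> \<le> 1 * r}"
      using gtk lt[OF True] k(2) by (intro bound) (smt (verit, best))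
    then show ?thesis using lu by force
  next
    case False
    then have g: "?\<rho> > 1/3" using assms(2) pr(1) by simp
    \<comment> \<open>The potential does not decrease outwards, so no loop rotates faster than the cycle.\<close>
    have "{l..u} \<subseteq> {r. - 1 * ?\<rho> \<le> - 1 * r}"
      using gtk gt[OF g] k(2) by (intro bound) (smt (verit, best))
    then show ?thesis using lu by force
  qed
  then show ?thesis unfolding frontier_pattern_def pr using lu by blast
qed

end
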